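(* Let $G$ and $H$ be finite simple graphs, each of order at least $2$, such that the Cartesian product $G \,\Box\, H$ is connected. Then $G \,\Box\, H$ is well-dominated if and only if $G \,\Box\, H$ is isomorphic to $P_3 \,\Box\, K_3$ or $G \,\Box\, H$ is isomorphic to $K_n \,\Box\, K_n$ for some $n \ge 2$.
   Context: All graphs are finite and simple (undirected, no loops, no multiple edges). The order of a graph is its number of vertices. For a graph $X$ and $S \subseteq V(X)$, the closed neighborhood $N[S]$ is $S$ together with all vertices adjacent to some vertex of $S$. A dominating set of $X$ is a set $S \subseteq V(X)$ with $N[S] = V(X)$; it is minimal if $S - \{x\}$ does not dominate $X$ for every $x \in S$. The domination number $\gamma(X)$ is the cardinality of a smallest dominating set of $X$. The graph $X$ is well-dominated if all of its minimal dominating sets have the same cardinality, namely $\gamma(X)$. The Cartesian product $X \,\Box\, Y$ has vertex set $V(X) \times V(Y)$, and two vertices $(x_1,y_1)$ and $(x_2,y_2)$ are adjacent if they are equal in one coordinate and adjacent in the other coordinate. $P_3$ is the path on three vertices and $K_n$ is the complete graph on $n$ vertices. *)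

theory Defs
  imports "Graph_Theory.Graph_Theory"
begin

text \<open>
  A finite simple graph is a \<^locale>\<open>pair_graph\<close>: a finite vertex set \<^const>\<open>pverts\<close> with a symmetric
  irreflexive relation \<^const>\<open>parcs\<close>, each edge being represented by its two arcs.  The coercion
  \<^const>\<open>with_proj\<close> makes the library notions \<^const>\<open>connected\<close> and \<^const>\<open>digraph_iso\<close> applicable.
\<close>

definition closed_neighborhood :: "'a pair_pre_digraph \<Rightarrow> 'a set \<Rightarrow> 'a set" where
  "closed_neighborhood X S = S \<union> {v \<in> pverts X. \<exists>u\<in>S. (u, v) \<in> parcs X}"

definition dominating_set :: "'a pair_pre_digraph \<Rightarrow> 'a set \<Rightarrow> bool" where
  "dominating_set X S \<longleftrightarrow> S \<subseteq> pverts X \<and> closed_neighborhood X S = pverts X"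

definition minimal_dominating_set :: "'a pair_pre_digraph \<Rightarrow> 'a set \<Rightarrow> bool" where
  "minimal_dominating_set X S \<longleftrightarrow>
     dominating_set X S \<and> (\<forall>x\<in>S. \<not> dominating_set X (S - {x}))"

definition domination_number :: "'a pair_pre_digraph \<Rightarrow> nat" where
  "domination_number X = (LEAST k. \<exists>S. dominating_set X S \<and> card S = k)"

definition well_dominated :: "'a pair_pre_digraph \<Rightarrow> bool" where
  "well_dominated X \<longleftrightarrow>
     (\<forall>S. minimal_dominating_set X S \<longrightarrow> card S = domination_number X)"

definition cartesian_product ::
  "'a pair_pre_digraph \<Rightarrow> 'b pair_pre_digraph \<Rightarrow> ('a \<times> 'b) pair_pre_digraph"  (infixr \<open>\<box>\<close> 70) where
  "X \<box> Y = \<lparr> pverts = pverts X \<times> pverts Y,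
     parcs = {((x1, y1), (x2, y2)) | x1 y1 x2 y2.
       x1 \<in> pverts X \<and> x2 \<in> pverts X \<and> y1 \<in> pverts Y \<and> y2 \<in> pverts Y \<and>
       (x1 = x2 \<and> (y1, y2) \<in> parcs Y \<or> y1 = y2 \<and> (x1, x2) \<in> parcs X)} \<rparr>"

definition complete_graph :: "nat \<Rightarrow> nat pair_pre_digraph" where
  "complete_graph n = \<lparr> pverts = {..<n}, parcs = {(i, j). i < n \<and> j < n \<and> i \<noteq> j} \<rparr>"

text \<open>The index of \<open>path_graph n\<close> is its number of vertices, so \<open>path_graph 3\<close> has two edges.\<close>

definition path_graph :: "nat \<Rightarrow> nat pair_pre_digraph" where
  "path_graph n = \<lparr> pverts = {..<n}, parcs = {(i, j). i < n \<and> j < n \<and> (j = Suc i \<or> i = Suc j)} \<rparr>"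

lemma complete_digraph_complete_graph: "K\<^bsub>n\<^esub> (with_proj (complete_graph n))"
  by (auto simp: complete_digraph_pair_def complete_graph_def)

lemma pair_graph_complete_graph: "pair_graph (complete_graph n)"
  using complete_digraph_complete_graph by (rule pair_graphI_complete)

lemma pair_graph_path_graph: "pair_graph (path_graph n)"
proof -
  have "parcs (path_graph n) \<subseteq> {..<n} \<times> {..<n}"
    by (auto simp: path_graph_def)
  then have "finite (parcs (path_graph n))"
    by (rule finite_subset) simp
  then show ?thesis
    by unfold_locales (auto simp: path_graph_def symmetric_def intro: symI)
qed

lemma pair_graph_cartesian_product:
  assumes "pair_graph X" "pair_graph Y"
  shows "pair_graph (X \<box> Y)"
proof -
  interpret X: pair_graph X by fact
  interpret Y: pair_graph Y by fact
  have "parcs (X \<box> Y) \<subseteq> (pverts X \<times> pverts Y) \<times> (pverts X \<times> pverts Y)"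
    by (auto simp: cartesian_product_def)
  then have "finite (parcs (X \<box> Y))"
    by (rule finite_subset) (simp add: X.pair_finite_verts Y.pair_finite_verts)
  then show ?thesis
    by unfold_locales
      (auto simp: cartesian_product_def symmetric_def X.pair_finite_verts Y.pair_finite_verts
        dest: X.no_loops' Y.no_loops' intro!: symI intro: X.arcs_symmetric Y.arcs_symmetric)
qed

text \<open>
  For graphs given by pairs, \<^const>\<open>digraph_iso\<close> is the usual isomorphism of simple graphs: the map on
  arcs is determined by the map on vertices.
\<close>

lemma digraph_iso_pair_iff:
  assumes "pair_graph X" "pair_graph Y"
  shows "digraph_iso (with_proj X) (with_proj Y) \<longleftrightarrow>
    (\<exists>f. bij_betw f (pverts X) (pverts Y) \<and>
      (\<forall>u\<in>pverts X. \<forall>v\<in>pverts X. (u, v) \<in> parcs X \<longleftrightarrow> (f u, f v) \<in> parcs Y))"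
    (is "?L \<longleftrightarrow> ?R")
proof -
  interpret X: pair_graph X by fact
  interpret Y: pair_graph Y by fact
  show ?thesis
  proof
    assume ?L
    then obtain h where h: "pre_digraph.digraph_isomorphism (with_proj X) h"
      and Y: "with_proj Y = app_iso h (with_proj X)"
      unfolding digraph_iso_def by blast
    define f where "f = iso_verts h"
    from Y have V: "pverts Y = f ` pverts X" and A: "parcs Y = iso_arcs h ` parcs X"
      and th: "iso_tail h = fst" "iso_head h = snd"
      by (simp_all add: with_proj_def app_iso_def f_def)
    from h have inj: "inj_on f (pverts X)"
      and arc: "\<And>a. a \<in> parcs X \<Longrightarrow> iso_arcs h a = (f (fst a), f (snd a))"
      by (auto simp: pre_digraph.digraph_isomorphism_def th f_def prod_eq_iff)
    have A': "parcs Y = (\<lambda>a. (f (fst a), f (snd a))) ` parcs X"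
      using A arc by simp
    have "(u, v) \<in> parcs X \<longleftrightarrow> (f u, f v) \<in> parcs Y" if "u \<in> pverts X" "v \<in> pverts X" for u v
    proof
      assume "(f u, f v) \<in> parcs Y"
      then obtain a b where ab: "(a, b) \<in> parcs X" "f u = f a" "f v = f b"
        unfolding A' by auto
      then have "u = a" "v = b"
        using inj that X.in_arcsD1 X.in_arcsD2 by (auto dest: inj_onD)
      with ab show "(u, v) \<in> parcs X" by simp
    qed (force simp: A')
    with inj V show ?R by (auto simp: bij_betw_def)
  next
    assume ?R
    then obtain f where f: "bij_betw f (pverts X) (pverts Y)"
      and e: "\<And>u v. u \<in> pverts X \<Longrightarrow> v \<in> pverts X \<Longrightarrow> (u, v) \<in> parcs X \<longleftrightarrow> (f u, f v) \<in> parcs Y"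
      by blast
    define h where "h = \<lparr> iso_verts = f, iso_arcs = map_prod f f, iso_head = snd, iso_tail = fst \<rparr>"
    have inj: "inj_on f (pverts X)" and V: "pverts Y = f ` pverts X"
      using f by (auto simp: bij_betw_def)
    have "inj_on (map_prod f f) (parcs X)"
      by (intro inj_on_subset[OF map_prod_inj_on[OF inj inj]])
        (auto dest: X.in_arcsD1 X.in_arcsD2)
    then have "pre_digraph.digraph_isomorphism (with_proj X) h"
      using inj X.wf_digraph by (simp add: pre_digraph.digraph_isomorphism_def h_def)
    moreover have "parcs Y = map_prod f f ` parcs X"
    proof (intro equalityI subrelI)
      fix a b assume ab: "(a, b) \<in> parcs Y"
      then obtain u v where "a = f u" "b = f v" "u \<in> pverts X" "v \<in> pverts X"
        using V Y.in_arcsD1 Y.in_arcsD2 by blast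
      with e ab show "(a, b) \<in> map_prod f f ` parcs X" by force
    qed (use e in \<open>auto dest: X.in_arcsD1 X.in_arcsD2\<close>)
    ultimately show ?L
      unfolding digraph_iso_def
      by (intro exI[of _ h]) (simp add: app_iso_def with_proj_def h_def V)
  qed
qed

end

theory Submission
  imports Defs
begin

text \<open>
  In a well-dominated graph no dominating set has fewer than \<open>\<gamma>\<close> elements, and no set of elements with
  private neighbors in a dominating set has more.  Let \<open>D\<close> be a dominating set of \<open>H\<close> all of whose
  elements have external private neighbors (Bollobas and Cockayne).  Then \<open>V(G) \<times> D\<close> is a minimal
  dominating set of \<open>G \<box> H\<close>, so \<open>\<gamma>(G \<box> H) = |G| |D|\<close>.  Replacing the fibers over \<open>N[a]\<close> by the single
  fiber \<open>{a} \<times> V(H)\<close> gives \<open>|N[a]| |D| \<le> |H|\<close>.  By symmetry both factors have the same maximum degree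
  \<open>r - 1\<close>, and \<open>\<gamma>(G \<box> H) = |G| |H| / r\<close>.

  Given proper colorings of \<open>G\<close> and \<open>H\<close> with \<open>r\<close> colors, the sum of the colors modulo \<open>r\<close> splits
  \<open>G \<box> H\<close> into \<open>r\<close> independent sets, which must then all be maximal.  If neither factor is complete,
  greedy colorings that omit a color in some closed neighborhood contradict this.

  So let \<open>G = K\<^sub>r\<close>, whence \<open>\<gamma>(G \<box> H) = |H|\<close>.  The dominating sets
  \<open>V(G) \<times> A \<union> {g} \<times> (V(H) - N[A])\<close> with \<open>|A| \<le> 2\<close> show that adjacent vertices of \<open>H\<close> have comparable
  closed neighborhoods and that \<open>|N[b]| \<ge> r - 1\<close>.  Therefore \<open>H\<close> has a universal vertex \<open>a\<close>, has order \<open>r\<close>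
  and lacks at most one edge \<open>uu'\<close>.  If it lacks one and \<open>r \<ge> 4\<close>, then \<open>(g, u)\<close>, \<open>(g, u')\<close> and the \<open>(y, a)\<close>
  with \<open>y \<noteq> g\<close> form a minimal dominating set of size \<open>r + 1\<close>, which is too large.
\<close>

lemma pair_graph_facts:
  assumes "pair_graph X"
  shows finite_pverts: "finite (pverts X)"
    and parcs_sym: "(u, v) \<in> parcs X \<longleftrightarrow> (v, u) \<in> parcs X"
    and parcs_irrefl: "(u, u) \<notin> parcs X"
    and parcs_verts: "(u, v) \<in> parcs X \<Longrightarrow> u \<in> pverts X" "(u, v) \<in> parcs X \<Longrightarrow> v \<in> pverts X"
proof -
  interpret pair_graph X by fact
  show "finite (pverts X)" by (rule pair_finite_verts)
  show "(u, v) \<in> parcs X \<longleftrightarrow> (v, u) \<in> parcs X" using arcs_symmetric by blast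
  show "(u, u) \<notin> parcs X" using no_loops' by blast
  show "(u, v) \<in> parcs X \<Longrightarrow> u \<in> pverts X" "(u, v) \<in> parcs X \<Longrightarrow> v \<in> pverts X"
    using in_arcsD1 in_arcsD2 by auto
qed

section \<open>Dominating sets\<close>

lemma dominating_set_iff:
  "dominating_set X S \<longleftrightarrow>
    S \<subseteq> pverts X \<and> (\<forall>v\<in>pverts X. \<exists>u\<in>S. u = v \<or> (u, v) \<in> parcs X)"
  unfolding dominating_set_def closed_neighborhood_def by blast

lemma dominating_set_superset:
  "dominating_set X S \<Longrightarrow> S \<subseteq> T \<Longrightarrow> T \<subseteq> pverts X \<Longrightarrow> dominating_set X T"
  unfolding dominating_set_iff by blast

lemma domination_number_le: "dominating_set X S \<Longrightarrow> domination_number X \<le> card S"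
  unfolding domination_number_def by (rule Least_le) blast

lemma minimal_dominating_subset:
  assumes "finite (pverts X)" "dominating_set X S"
  obtains M where "minimal_dominating_set X M" "M \<subseteq> S"
proof -
  let ?A = "{M. dominating_set X M}"
  have "finite ?A"
    by (rule finite_subset[of _ "Pow (pverts X)"]) (auto simp: dominating_set_def assms(1))
  then obtain M where M: "M \<in> ?A" "M \<subseteq> S" "\<And>N. N \<in> ?A \<Longrightarrow> N \<subseteq> M \<Longrightarrow> M = N"
    using finite_has_minimal2[of ?A S] assms(2) by auto
  have "minimal_dominating_set X M"
    unfolding minimal_dominating_set_def using M by blast
  then show thesis using M(2) that by blast
qed

text \<open>When \<open>S\<close> dominates \<open>X\<close>, some element of \<open>S\<close>
  dominates \<open>v\<close>, and the condition leaves only \<open>x\<close>; so \<open>x\<close>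
  dominates \<open>v\<close> and nothing else in \<open>S\<close> does. The case
  \<open>v = x\<close> is allowed.\<close>

definition private_neighbor :: "'a pair_pre_digraph \<Rightarrow> 'a set \<Rightarrow> 'a \<Rightarrow> 'a \<Rightarrow> bool" where
  "private_neighbor X S x v \<longleftrightarrow> v \<in> pverts X \<and> (\<forall>u\<in>S. u = v \<or> (u, v) \<in> parcs X \<longrightarrow> u = x)"

text \<open>A minimal dominating set inside \<open>S\<close> must keep every
  \<open>x \<in> T\<close>, since nothing else in \<open>S\<close> dominates its private neighbor.
  As \<open>T\<close> may be smaller than \<open>S\<close>, nothing has to be known about the rest
  of \<open>S\<close>.\<close>

lemma card_private_le:
  assumes "finite (pverts X)" "well_dominated X" "dominating_set X S" "T \<subseteq> S"
    and "\<And>x. x \<in> T \<Longrightarrow> \<exists>v. private_neighbor X S x v"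
  shows "card T \<le> domination_number X"
proof -
  obtain M where M: "minimal_dominating_set X M" "M \<subseteq> S"
    using minimal_dominating_subset assms by blast
  have "T \<subseteq> M"
  proof
    fix x assume "x \<in> T"
    then obtain v where "private_neighbor X S x v" using assms(5) by blast
    then have v: "v \<in> pverts X" "\<And>u. u \<in> S \<Longrightarrow> u = v \<or> (u, v) \<in> parcs X \<Longrightarrow> u = x"
      unfolding private_neighbor_def by auto
    have "dominating_set X M" using M(1) unfolding minimal_dominating_set_def by blast
    then obtain u where "u \<in> M" "u = v \<or> (u, v) \<in> parcs X"
      using v(1) unfolding dominating_set_iff by blast
    then show "x \<in> M" using v(2)[of u] M(2) by blast
  qed
  moreover have "finite M"
    using M assms(1) unfolding minimal_dominating_set_def dominating_set_def
    by (auto dest: finite_subset)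
  ultimately have "card T \<le> card M" by (simp add: card_mono)
  then show ?thesis using M(1) assms(2) unfolding well_dominated_def by auto
qed

text \<open>Without a private neighbor of \<open>x\<close>, the set \<open>S - {x}\<close> would
  dominate with fewer than \<gamma> elements.\<close>

lemma private_neighbor_of_minimum:
  assumes "finite (pverts X)" "dominating_set X S" "card S \<le> domination_number X" "x \<in> S"
  shows "\<exists>v. private_neighbor X S x v"
proof -
  have fin: "finite S" using assms(1,2) finite_subset unfolding dominating_set_def by blast
  have "\<not> dominating_set X (S - {x})"
    using domination_number_le[of X "S - {x}"] assms(3,4) card_Diff1_less[OF fin assms(4)] by linarith
  moreover have "S - {x} \<subseteq> pverts X" using assms(2) unfolding dominating_set_def by blast
  ultimately obtain v where "v \<in> pverts X" "\<And>u. u \<in> S - {x} \<Longrightarrow> \<not> (u = v \<or> (u, v) \<in> parcs X)"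
    unfolding dominating_set_iff by blast
  then have "private_neighbor X S x v" unfolding private_neighbor_def by auto
  then show ?thesis by blast
qed

text \<open>A maximal independent set containing \<open>S\<close> is dominating, and each of its
  elements is its own private neighbor.\<close>

lemma card_independent_le:
  assumes X: "pair_graph X" and wd: "well_dominated X" and "S \<subseteq> pverts X"
    and "\<And>u v. u \<in> S \<Longrightarrow> v \<in> S \<Longrightarrow> (u, v) \<notin> parcs X"
  shows "card S \<le> domination_number X"
proof -
  have fin: "finite (pverts X)" using X by (rule finite_pverts)
  let ?A = "{M. M \<subseteq> pverts X \<and> (\<forall>u\<in>M. \<forall>v\<in>M. (u, v) \<notin> parcs X)}"
  have "finite ?A" by (rule finite_subset[of _ "Pow (pverts X)"]) (auto simp: fin)
  then obtain M where M: "M \<in> ?A" "S \<subseteq> M" "\<And>N. N \<in> ?A \<Longrightarrow> M \<subseteq> N \<Longrightarrow> M = N"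
    using finite_has_maximal2[of ?A S] assms(3,4) by auto
  have dom: "dominating_set X M"
    unfolding dominating_set_iff
  proof (intro conjI ballI)
    show "M \<subseteq> pverts X" using M by blast
    fix v assume v: "v \<in> pverts X"
    show "\<exists>u\<in>M. u = v \<or> (u, v) \<in> parcs X"
    proof (rule ccontr)
      assume n: "\<not> ?thesis"
      then have "insert v M \<in> ?A"
        using M(1) v parcs_sym[OF X] parcs_irrefl[OF X] by blast
      then show False using M(3)[of "insert v M"] n by blast
    qed
  qed
  have "card M \<le> domination_number X"
  proof (rule card_private_le[OF fin wd dom subset_refl])
    fix x assume "x \<in> M"
    then have "private_neighbor X M x x"
      using M(1) unfolding private_neighbor_def by blast
    then show "\<exists>v. private_neighbor X M x v" by blast
  qed
  moreover have "card S \<le> card M"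
    using M(1,2) fin by (intro card_mono) (auto dest: finite_subset)
  ultimately show ?thesis by linarith
qed

text \<open>A minimal dominating set coincides with the \<open>D\<close> found inside it, and
  \<open>n\<close> bounds all dominating sets from below. So the examples need no enumeration of
  minimal dominating sets.\<close>

lemma well_dominatedI:
  assumes fin: "finite (pverts X)"
    and sub: "\<And>S. dominating_set X S \<Longrightarrow> \<exists>D\<subseteq>S. dominating_set X D \<and> card D = n"
  shows "well_dominated X"
proof -
  have "dominating_set X (pverts X)" unfolding dominating_set_iff by blast
  then have ex: "\<exists>S. dominating_set X S \<and> card S = n" using sub by blast
  have "n \<le> card S" if "dominating_set X S" for S
    using sub[OF that] that fin card_mono finite_subset unfolding dominating_set_def by metis
  then have dn: "domination_number X = n"
    unfolding domination_number_def using ex by (intro Least_equality) auto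
  have "card S = n" if S: "minimal_dominating_set X S" for S
  proof -
    have dS: "dominating_set X S" using S unfolding minimal_dominating_set_def by blast
    obtain D where D: "D \<subseteq> S" "dominating_set X D" "card D = n" using sub[OF dS] by blast
    have "x \<in> D" if x: "x \<in> S" for x
    proof (rule ccontr)
      assume "x \<notin> D"
      then have "dominating_set X (S - {x})"
        using dominating_set_superset[OF D(2), of "S - {x}"] D(1) dS
        unfolding dominating_set_def by blast
      then show False using S x unfolding minimal_dominating_set_def by blast
    qed
    then show ?thesis using D by (metis subsetI subset_antisym)
  qed
  then show ?thesis unfolding well_dominated_def dn by blast
qed

section \<open>Isomorphisms of simple graphs as bijections of vertices\<close>

definition graph_isomorphic :: "'a pair_pre_digraph \<Rightarrow> 'b pair_pre_digraph \<Rightarrow> bool" where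
  "graph_isomorphic X Y \<longleftrightarrow> (\<exists>f. bij_betw f (pverts X) (pverts Y) \<and>
      (\<forall>u\<in>pverts X. \<forall>v\<in>pverts X. (u, v) \<in> parcs X \<longleftrightarrow> (f u, f v) \<in> parcs Y))"

lemma graph_isomorphic_trans:
  assumes "graph_isomorphic X Y" "graph_isomorphic Y Z"
  shows "graph_isomorphic X Z"
proof -
  obtain f where f: "bij_betw f (pverts X) (pverts Y)"
    "\<And>u v. u\<in>pverts X \<Longrightarrow> v\<in>pverts X \<Longrightarrow> (u, v) \<in> parcs X \<longleftrightarrow> (f u, f v) \<in> parcs Y"
    using assms(1) unfolding graph_isomorphic_def by blast
  obtain g where g: "bij_betw g (pverts Y) (pverts Z)"
    "\<And>u v. u\<in>pverts Y \<Longrightarrow> v\<in>pverts Y \<Longrightarrow> (u, v) \<in> parcs Y \<longleftrightarrow> (g u, g v) \<in> parcs Z"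
    using assms(2) unfolding graph_isomorphic_def by blast
  have "bij_betw (g \<circ> f) (pverts X) (pverts Z)" using f(1) g(1) by (rule bij_betw_trans)
  moreover have "(u, v) \<in> parcs X \<longleftrightarrow> ((g \<circ> f) u, (g \<circ> f) v) \<in> parcs Z"
    if "u \<in> pverts X" "v \<in> pverts X" for u v
    using that f(2) g(2)[of "f u" "f v"] bij_betwE[OF f(1)] by simp
  ultimately show ?thesis unfolding graph_isomorphic_def by blast
qed

text \<open>A minimal dominating set of \<open>Y\<close> inside the image of \<open>S\<close> pulls
  back to a dominating subset of \<open>S\<close> of size \<gamma>(\<open>Y\<close>).\<close>

lemma well_dominated_isomorphic:
  assumes fin: "finite (pverts X)" "finite (pverts Y)"
    and iso: "graph_isomorphic X Y" and wd: "well_dominated Y"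
  shows "well_dominated X"
proof (rule well_dominatedI[OF fin(1)])
  obtain f where f: "bij_betw f (pverts X) (pverts Y)"
    and arcs: "\<And>u v. u\<in>pverts X \<Longrightarrow> v\<in>pverts X \<Longrightarrow> (u, v) \<in> parcs X \<longleftrightarrow> (f u, f v) \<in> parcs Y"
    using iso unfolding graph_isomorphic_def by blast
  have img: "f ` pverts X = pverts Y" and inj: "inj_on f (pverts X)"
    using f by (auto simp: bij_betw_def)
  have dom: "dominating_set X S \<longleftrightarrow> dominating_set Y (f ` S)" if S: "S \<subseteq> pverts X" for S
  proof -
    have *: "(u = v \<or> (u, v) \<in> parcs X) \<longleftrightarrow> (f u = f v \<or> (f u, f v) \<in> parcs Y)"
      if "u \<in> S" "v \<in> pverts X" for u v
      using that S arcs inj by (auto dest: inj_onD)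
    show ?thesis
      unfolding dominating_set_iff img[symmetric] using S * by (simp add: image_mono)
  qed
  fix S assume S: "dominating_set X S"
  then have SX: "S \<subseteq> pverts X" by (simp add: dominating_set_def)
  obtain M where M: "minimal_dominating_set Y M" "M \<subseteq> f ` S"
    using minimal_dominating_subset[OF fin(2)] dom[OF SX] S by blast
  define D where "D = {x \<in> S. f x \<in> M}"
  have fD: "f ` D = M" using M(2) unfolding D_def by blast
  have DX: "D \<subseteq> pverts X" using SX unfolding D_def by blast
  have "card D = card M" using card_image[OF inj_on_subset[OF inj DX]] fD by simp
  then have "card D = domination_number Y" using wd M(1) unfolding well_dominated_def by simp
  moreover have "dominating_set X D"
    using dom[OF DX] fD M(1) unfolding minimal_dominating_set_def by simp
  moreover have "D \<subseteq> S" unfolding D_def by simp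
  ultimately show "\<exists>D\<subseteq>S. dominating_set X D \<and> card D = domination_number Y" by blast
qed

section \<open>Connected graphs\<close>

definition indecomposable :: "'a pair_pre_digraph \<Rightarrow> bool" where
  "indecomposable X \<longleftrightarrow>
    (\<forall>C\<subseteq>pverts X. C \<noteq> {} \<longrightarrow> (\<forall>x\<in>C. \<forall>y. (x, y) \<in> parcs X \<longrightarrow> y \<in> C) \<longrightarrow> C = pverts X)"

lemma indecomposableD:
  assumes "indecomposable X" "C \<subseteq> pverts X" "c \<in> C"
    and "\<And>x y. x \<in> C \<Longrightarrow> (x, y) \<in> parcs X \<Longrightarrow> y \<in> C"
  shows "C = pverts X"
  using assms unfolding indecomposable_def by blast

lemma indecomposable_neighbor:
  assumes X: "pair_graph X" and ind: "indecomposable X" and card: "card (pverts X) \<ge> 2"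
    and x: "x \<in> pverts X"
  shows "\<exists>y. (x, y) \<in> parcs X"
proof (rule ccontr)
  assume ex: "\<not> ?thesis"
  have "{x} = pverts X"
    by (rule indecomposableD[OF ind, of "{x}" x]) (use ex x in auto)
  then show False using card by (auto dest: arg_cong[of _ _ card])
qed

text \<open>Without an induced path on three vertices, no arc leaves the closed neighborhood of
  \<open>x\<close>; it would then be everything, including \<open>y\<close>.\<close>

lemma indecomposable_incomplete:
  assumes X: "pair_graph X" and ind: "indecomposable X"
    and xy: "x \<in> pverts X" "y \<in> pverts X" "x \<noteq> y" "(x, y) \<notin> parcs X"
  shows "\<exists>u a v. (u, a) \<in> parcs X \<and> (a, v) \<in> parcs X \<and> u \<noteq> v \<and> (u, v) \<notin> parcs X"
proof (rule ccontr)
  assume ex: "\<not> ?thesis"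
  have *: "u = v \<or> (u, v) \<in> parcs X" if that2: "(u, a) \<in> parcs X" "(a, v) \<in> parcs X" for u a v
    using that2 ex by blast
  have "insert x {v. (x, v) \<in> parcs X} = pverts X"
  proof (rule indecomposableD[OF ind, of _ x])
    show "insert x {v. (x, v) \<in> parcs X} \<subseteq> pverts X" using xy parcs_verts[OF X] by blast
    fix y z assume y: "y \<in> insert x {v. (x, v) \<in> parcs X}" "(y, z) \<in> parcs X"
    then show "z \<in> insert x {v. (x, v) \<in> parcs X}" using *[of x y z] by auto
  qed simp
  then show False using xy by auto
qed

text \<open>If no arc of one factor leaves \<open>C\<close>, then no arc of the product leaves the
  union of the fibers over \<open>C\<close>, so reachability in the product cannot leave it
  either.\<close>

lemma indecomposable_factors:
  assumes G: "pair_graph G" and H: "pair_graph H" and con: "connected (with_proj (G \<box> H))"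
  shows "indecomposable G" "indecomposable H"
proof -
  let ?X = "mk_symmetric (with_proj (G \<box> H))"
  have X: "pair_graph (G \<box> H)" using G H by (rule pair_graph_cartesian_product)
  \<comment> \<open>Connectedness refers to the symmetric closure, which adds nothing to arcs that
    are already symmetric.\<close>
  have arcs: "(u, v) \<in> parcs ?X \<longleftrightarrow> (u, v) \<in> parcs (G \<box> H)" for u v
    using parcs_sym[OF X, of u v] by (force simp: parcs_mk_symmetric)
  have "pverts (G \<box> H) \<noteq> {}"
    and reach: "\<And>u v. u \<in> pverts (G \<box> H) \<Longrightarrow> v \<in> pverts (G \<box> H) \<Longrightarrow>
      (u, v) \<in> rtrancl_on (pverts ?X) (parcs ?X)"
    using con by (auto simp: connected_def strongly_connected_def reachable_def)
  then have ne: "pverts G \<noteq> {}" "pverts H \<noteq> {}" by (auto simp: cartesian_product_def)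
  have closed: "v \<in> C" if "C \<subseteq> pverts (G \<box> H)" "u \<in> C" "v \<in> pverts (G \<box> H)"
    and C: "\<And>x y. x \<in> C \<Longrightarrow> (x, y) \<in> parcs (G \<box> H) \<Longrightarrow> y \<in> C" for C u v
  proof -
    have "(u, v) \<in> rtrancl_on (pverts ?X) (parcs ?X)" using reach that by blast
    then show "v \<in> C" using \<open>u \<in> C\<close> by induction (use C arcs in auto)
  qed
  show "indecomposable G"
    unfolding indecomposable_def
  proof (intro allI impI)
    fix C assume C: "C \<subseteq> pverts G" "C \<noteq> {}" "\<forall>x\<in>C. \<forall>y. (x, y) \<in> parcs G \<longrightarrow> y \<in> C"
    obtain x h where "x \<in> C" "h \<in> pverts H" using C(2) ne by blast
    then have "(y, h) \<in> C \<times> pverts H" if "y \<in> pverts G" for y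
      using C that by (intro closed[of "C \<times> pverts H" "(x, h)" "(y, h)"])
        (auto simp: cartesian_product_def)
    then show "C = pverts G" using C(1) by auto
  qed
  show "indecomposable H"
    unfolding indecomposable_def
  proof (intro allI impI)
    fix C assume C: "C \<subseteq> pverts H" "C \<noteq> {}" "\<forall>x\<in>C. \<forall>y. (x, y) \<in> parcs H \<longrightarrow> y \<in> C"
    obtain x g where "x \<in> C" "g \<in> pverts G" using C(2) ne by blast
    then have "(g, y) \<in> pverts G \<times> C" if "y \<in> pverts H" for y
      using C that by (intro closed[of "pverts G \<times> C" "(g, x)" "(g, y)"])
        (auto simp: cartesian_product_def)
    then show "C = pverts H" using C(1) by auto
  qed
qed

text \<open>
  The theorem of Bollobas and Cockayne: a minimum dominating set with the fewest isolated vertices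
  has the required property, since an isolated vertex without an external private neighbor could
  be exchanged for any of its neighbors.
\<close>

lemma external_private_neighbors:
  assumes X: "pair_graph X" and nbr: "\<And>x. x \<in> pverts X \<Longrightarrow> \<exists>y. (x, y) \<in> parcs X"
  obtains D where "dominating_set X D"
    "\<And>d. d \<in> D \<Longrightarrow> \<exists>p\<in>pverts X - D. private_neighbor X D d p"
proof -
  define iso where "iso D = {d \<in> D. \<forall>e\<in>D. (d, e) \<notin> parcs X}" for D
  have fin: "finite (pverts X)" using X by (rule finite_pverts)
  have "\<exists>D. dominating_set X D \<and> card D = domination_number X"
    unfolding domination_number_def
    by (rule LeastI_ex) (auto simp: dominating_set_iff)
  then obtain D where D: "dominating_set X D" "card D = domination_number X"
    and min: "\<And>D'. dominating_set X D' \<and> card D' = domination_number X \<Longrightarrow>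
      card (iso D) \<le> card (iso D')"
    using ex_has_least_nat[of "\<lambda>D. dominating_set X D \<and> card D = domination_number X" _
        "\<lambda>D. card (iso D)"] by blast
  have DX: "D \<subseteq> pverts X" using D(1) by (simp add: dominating_set_def)
  have finD: "finite D" using DX fin by (rule finite_subset)
  have "\<exists>p\<in>pverts X - D. private_neighbor X D d p" if d: "d \<in> D" for d
  proof (rule ccontr)
    assume no: "\<not> ?thesis"
    obtain v where v: "private_neighbor X D d v"
      using private_neighbor_of_minimum[OF fin D(1) _ d] D(2) by auto
    \<comment> \<open>No private neighbor of \<open>d\<close> is external, so \<open>v\<close> is
      \<open>d\<close> itself and \<open>d\<close> is isolated in \<open>D\<close>.\<close>
    then have "v \<in> D" using no unfolding private_neighbor_def by blast
    then have vd: "v = d" using v unfolding private_neighbor_def by blast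
    have isod: "(e, d) \<notin> parcs X" if "e \<in> D" for e
      using v that parcs_irrefl[OF X] unfolding private_neighbor_def vd by blast
    obtain y where y: "(d, y) \<in> parcs X" using nbr d DX by blast
    have yX: "y \<in> pverts X" using parcs_verts[OF X y] by simp
    have yD: "y \<notin> D" using y isod parcs_sym[OF X] by blast
    then obtain e where e: "e \<in> D" "(e, y) \<in> parcs X" "e \<noteq> d"
      using no yX y unfolding private_neighbor_def by blast
    \<comment> \<open>The exchange keeps the size. It removes the isolated vertex \<open>d\<close>,
      and its replacement \<open>y\<close> is not isolated because \<open>e\<close> remains.\<close>
    let ?D = "insert y (D - {d})"
    have dom: "dominating_set X ?D"
      unfolding dominating_set_iff
    proof (intro conjI ballI)
      show "?D \<subseteq> pverts X" using DX yX by blast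
      fix w assume w: "w \<in> pverts X"
      show "\<exists>u\<in>?D. u = w \<or> (u, w) \<in> parcs X"
      proof (cases "w \<in> D")
        case True
        then show ?thesis using y parcs_sym[OF X, of d y] by (cases "w = d") auto
      next
        case False
        then obtain u where "u \<in> D" "u \<noteq> d" "u = w \<or> (u, w) \<in> parcs X"
          using no w unfolding private_neighbor_def by blast
        then show ?thesis by blast
      qed
    qed
    have "card ?D = Suc (card (D - {d}))" using yD finD by simp
    also have "\<dots> = card D" using finD d by (rule card_Suc_Diff1)
    finally have "card ?D = card D" .
    then have "card (iso D) \<le> card (iso ?D)" using min dom D(2) by auto
    moreover have "iso ?D \<subset> iso D"
    proof (rule psubsetI)
      show "iso ?D \<subseteq> iso D"
      proof
        fix x assume x: "x \<in> iso ?D"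
        have "x \<noteq> y" using x e parcs_sym[OF X, of e y] unfolding iso_def by blast
        then show "x \<in> iso D" using x isod unfolding iso_def by blast
      qed
      have "d \<in> iso D" using d isod parcs_sym[OF X] unfolding iso_def by blast
      moreover have "d \<notin> iso ?D" using yD d unfolding iso_def by blast
      ultimately show "iso ?D \<noteq> iso D" by blast
    qed
    moreover have "finite (iso D)" using finD unfolding iso_def by simp
    ultimately show False using psubset_card_mono by (meson leD)
  qed
  with D(1) that show thesis by blast
qed

lemma closed_neighborhood_singleton:
  "closed_neighborhood X {a} = insert a {v \<in> pverts X. (a, v) \<in> parcs X}"
  unfolding closed_neighborhood_def by blast

section \<open>Well-dominated products\<close>

lemma pverts_product [simp]: "pverts (X \<box> Y) = pverts X \<times> pverts Y"
  by (simp add: cartesian_product_def)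

lemma parcs_product [simp]:
  "((x, y), (x', y')) \<in> parcs (X \<box> Y) \<longleftrightarrow>
    x \<in> pverts X \<and> x' \<in> pverts X \<and> y \<in> pverts Y \<and> y' \<in> pverts Y \<and>
    (x = x' \<and> (y, y') \<in> parcs Y \<or> y = y' \<and> (x, x') \<in> parcs X)"
  by (simp add: cartesian_product_def)

lemma product_commute: "graph_isomorphic (X \<box> Y) (Y \<box> X)"
  unfolding graph_isomorphic_def
  by (intro exI[of _ prod.swap] conjI) (auto simp: bij_betw_def inj_on_def)

text \<open>Connectedness is required of each factor instead of the product, which makes the
  assumptions symmetric: by \<open>swap\<close> every result also holds with the factors
  exchanged.\<close>

locale well_dominated_product =
  fixes G :: "'a pair_pre_digraph" and H :: "'b pair_pre_digraph"
  assumes G: "pair_graph G" and H: "pair_graph H"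
    and card_G: "card (pverts G) \<ge> 2" and card_H: "card (pverts H) \<ge> 2"
    and indecomposable_G: "indecomposable G" and indecomposable_H: "indecomposable H"
    and well_dominated: "well_dominated (G \<box> H)"
begin

lemma swap: "well_dominated_product H G"
proof (rule well_dominated_product.intro)
  have "finite (pverts (H \<box> G))" "finite (pverts (G \<box> H))"
    using finite_pverts[OF G] finite_pverts[OF H] by auto
  then show "Defs.well_dominated (H \<box> G)"
    using well_dominated_isomorphic product_commute well_dominated by blast
qed (fact G H card_G card_H indecomposable_G indecomposable_H)+

lemma finite_product: "finite (pverts (G \<box> H))"
  using finite_pverts[OF G] finite_pverts[OF H] by simp

text \<open>Here \<open>d\<close> is the size of a dominating set \<open>D\<close> of
  \<open>H\<close> with external private neighbors. The last property holds because \<open>d\<close>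
  closed neighborhoods cover \<open>H\<close>, so the largest of them has at least the average
  share.\<close>

lemma domination_number_eq:
  obtains d where "0 < d" "domination_number (G \<box> H) = card (pverts G) * d"
    "\<And>a. a \<in> pverts G \<Longrightarrow> card (closed_neighborhood G {a}) * d \<le> card (pverts H)"
    "\<exists>b\<in>pverts H. card (pverts H) \<le> d * card (closed_neighborhood H {b})"
proof -
  have nbrG: "\<exists>y. (x, y) \<in> parcs G" if "x \<in> pverts G" for x
    using indecomposable_neighbor[OF G indecomposable_G card_G that] .
  have nbrH: "\<exists>y. (x, y) \<in> parcs H" if "x \<in> pverts H" for x
    using indecomposable_neighbor[OF H indecomposable_H card_H that] .
  obtain D where D: "dominating_set H D"
    and priv: "\<And>d. d \<in> D \<Longrightarrow> \<exists>p\<in>pverts H - D. private_neighbor H D d p"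
    using external_private_neighbors[OF H nbrH] by blast
  have DH: "D \<subseteq> pverts H" using D by (simp add: dominating_set_def)
  have finG: "finite (pverts G)" and finH: "finite (pverts H)"
    using G H by (simp_all add: finite_pverts)
  have finD: "finite D" using DH finH by (rule finite_subset)
  have dom_fiber: "\<exists>d\<in>D. d = h \<or> (d, h) \<in> parcs H" if "h \<in> pverts H" for h
    using that D unfolding dominating_set_iff by blast
  let ?W = "domination_number (G \<box> H)"
  have dom: "dominating_set (G \<box> H) (pverts G \<times> D)"
    unfolding dominating_set_iff
  proof (intro conjI ballI)
    show "pverts G \<times> D \<subseteq> pverts (G \<box> H)" using DH by auto
    fix v assume "v \<in> pverts (G \<box> H)"
    then obtain g h where v: "v = (g, h)" "g \<in> pverts G" "h \<in> pverts H" by auto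
    obtain d where "d \<in> D" "d = h \<or> (d, h) \<in> parcs H" using dom_fiber v by blast
    then show "\<exists>u\<in>pverts G \<times> D. u = v \<or> (u, v) \<in> parcs (G \<box> H)"
      using v DH by (intro bexI[of _ "(g, d)"]) auto
  qed
  have "card (pverts G \<times> D) \<le> ?W"
  proof (rule card_private_le[OF finite_product well_dominated dom subset_refl])
    fix x assume x: "x \<in> pverts G \<times> D"
    then obtain g d where gd: "x = (g, d)" "g \<in> pverts G" "d \<in> D" by blast
    obtain p where "p \<in> pverts H - D" "private_neighbor H D d p" using priv gd by blast
    then have p: "p \<in> pverts H" "p \<notin> D" "\<And>u. u \<in> D \<Longrightarrow> (u, p) \<in> parcs H \<Longrightarrow> u = d"
      unfolding private_neighbor_def by auto
    \<comment> \<open>Since \<open>p \<notin> D\<close>, no vertex of \<open>V(G) \<times> D\<close>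
      has second coordinate \<open>p\<close>; so \<open>(g, p)\<close> is dominated only within
      \<open>{g} \<times> V(H)\<close>, where \<open>(g, d)\<close> is the sole candidate.\<close>
    have "private_neighbor (G \<box> H) (pverts G \<times> D) x (g, p)"
      unfolding private_neighbor_def
    proof (intro conjI ballI impI)
      show "(g, p) \<in> pverts (G \<box> H)" using gd p by simp
      fix u assume "u \<in> pverts G \<times> D" "u = (g, p) \<or> (u, (g, p)) \<in> parcs (G \<box> H)"
      then show "u = x" using p gd by (cases u) auto
    qed
    then show "\<exists>v. private_neighbor (G \<box> H) (pverts G \<times> D) x v" by blast
  qed
  with domination_number_le[OF dom] have W: "?W = card (pverts G) * card D"
    by (simp add: card_cartesian_product)
  have "pverts H \<noteq> {}" using card_H by auto
  then have "D \<noteq> {}" using dom_fiber by blast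
  then have pos: "0 < card D" using finD by (simp add: card_gt_0_iff)
  have deg: "card (closed_neighborhood G {a}) * card D \<le> card (pverts H)" if a: "a \<in> pverts G" for a
  proof -
    let ?N = "closed_neighborhood G {a}"
    \<comment> \<open>The single fiber over \<open>a\<close> dominates all fibers over
      \<open>N[a]\<close>, and copies of \<open>D\<close> take care of the others. That this set has
      at least |G| |D| elements is the claimed inequality.\<close>
    let ?S = "{a} \<times> pverts H \<union> (pverts G - ?N) \<times> D"
    have N: "?N \<subseteq> pverts G" using a by (auto simp: closed_neighborhood_singleton)
    have "dominating_set (G \<box> H) ?S"
      unfolding dominating_set_iff
    proof (intro conjI ballI)
      show "?S \<subseteq> pverts (G \<box> H)" using a DH by auto
      fix v assume "v \<in> pverts (G \<box> H)"
      then obtain g h where v: "v = (g, h)" "g \<in> pverts G" "h \<in> pverts H" by auto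
      show "\<exists>u\<in>?S. u = v \<or> (u, v) \<in> parcs (G \<box> H)"
      proof (cases "g \<in> ?N")
        case True
        then show ?thesis
          using v a by (intro bexI[of _ "(a, h)"]) (auto simp: closed_neighborhood_singleton)
      next
        case False
        obtain d where "d \<in> D" "d = h \<or> (d, h) \<in> parcs H" using dom_fiber v by blast
        then show ?thesis using v False DH by (intro bexI[of _ "(g, d)"]) auto
      qed
    qed
    then have "?W \<le> card ?S" by (rule domination_number_le)
    also have "\<dots> \<le> card ({a} \<times> pverts H) + card ((pverts G - ?N) \<times> D)" by (rule card_Un_le)
    also have "\<dots> = card (pverts H) + (card (pverts G) - card ?N) * card D"
      using N finG by (simp add: card_cartesian_product card_Diff_subset finite_subset)
    finally show ?thesis
      using W mult_le_mono1[OF card_mono[OF finG N], of "card D"]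
        diff_mult_distrib[of "card (pverts G)" "card ?N" "card D"] by linarith
  qed
  have "\<exists>b\<in>pverts H. card (pverts H) \<le> card D * card (closed_neighborhood H {b})"
  proof -
    let ?c = "\<lambda>d. card (closed_neighborhood H {d})"
    have "Max (?c ` D) \<in> ?c ` D" using \<open>D \<noteq> {}\<close> finD by (intro Max_in) auto
    then obtain b where b: "b \<in> D" "?c b = Max (?c ` D)" by auto
    then have b': "?c d \<le> ?c b" if "d \<in> D" for d using that finD by simp
    have "pverts H \<subseteq> (\<Union>d\<in>D. closed_neighborhood H {d})"
    proof
      fix h assume h: "h \<in> pverts H"
      then obtain d where "d \<in> D" "d = h \<or> (d, h) \<in> parcs H" using dom_fiber by blast
      then show "h \<in> (\<Union>d\<in>D. closed_neighborhood H {d})"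
        using h by (intro UN_I[of d]) (auto simp: closed_neighborhood_singleton)
    qed
    moreover have "finite (\<Union>d\<in>D. closed_neighborhood H {d})"
      using finD finH by (simp add: closed_neighborhood_singleton)
    ultimately have "card (pverts H) \<le> card (\<Union>d\<in>D. closed_neighborhood H {d})"
      by (simp add: card_mono)
    also have "\<dots> \<le> (\<Sum>d\<in>D. card (closed_neighborhood H {d}))" by (rule card_UN_le[OF finD])
    also have "\<dots> \<le> card D * card (closed_neighborhood H {b})"
      using sum_bounded_above[of D "\<lambda>d. card (closed_neighborhood H {d})"] b' by simp
    finally show ?thesis using b(1) DH by blast
  qed
  with that[of "card D"] pos W deg show thesis by simp
qed

text \<open>With \<open>rG\<close> and \<open>rH\<close> the largest sizes of closed neighborhoods,
  \<open>rG * dH \<le> |H| \<le> rH * dH\<close> and \<open>rH * dG \<le> |G| \<le> rG * dG\<close>.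
  Hence \<open>rG = rH = r\<close>, and all four inequalities are equalities.\<close>

lemma orders:
  "\<exists>r dG dH. card (pverts G) = r * dG \<and> card (pverts H) = r * dH \<and>
    domination_number (G \<box> H) = r * dG * dH \<and> 0 < dG \<and> 0 < dH \<and>
    (\<forall>a\<in>pverts G. card (closed_neighborhood G {a}) \<le> r) \<and>
    (\<forall>b\<in>pverts H. card (closed_neighborhood H {b}) \<le> r)"
proof -
  interpret HG: well_dominated_product H G by (rule swap)
  have finG: "finite (pverts G)" and finH: "finite (pverts H)"
    using G H by (simp_all add: finite_pverts)
  have ne: "pverts G \<noteq> {}" "pverts H \<noteq> {}" using card_G card_H by auto
  define rG where "rG = Max ((\<lambda>a. card (closed_neighborhood G {a})) ` pverts G)"
  define rH where "rH = Max ((\<lambda>a. card (closed_neighborhood H {a})) ` pverts H)"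
  have rG: "card (closed_neighborhood G {a}) \<le> rG" if "a \<in> pverts G" for a
    using that finG unfolding rG_def by (intro Max_ge) auto
  have rH: "card (closed_neighborhood H {a}) \<le> rH" if "a \<in> pverts H" for a
    using that finH unfolding rH_def by (intro Max_ge) auto
  have "rG \<in> (\<lambda>a. card (closed_neighborhood G {a})) ` pverts G"
    unfolding rG_def using finG ne by (intro Max_in) auto
  then obtain a where a: "a \<in> pverts G" "card (closed_neighborhood G {a}) = rG" by auto
  have "rH \<in> (\<lambda>a. card (closed_neighborhood H {a})) ` pverts H"
    unfolding rH_def using finH ne by (intro Max_in) auto
  then obtain b where b: "b \<in> pverts H" "card (closed_neighborhood H {b}) = rH" by auto
  obtain dH where dH: "0 < dH" "domination_number (G \<box> H) = card (pverts G) * dH"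
    "rG * dH \<le> card (pverts H)" "card (pverts H) \<le> dH * rH"
  proof -
    obtain d b' where d: "0 < d" "domination_number (G \<box> H) = card (pverts G) * d"
      "card (closed_neighborhood G {a}) * d \<le> card (pverts H)" "b' \<in> pverts H"
      "card (pverts H) \<le> d * card (closed_neighborhood H {b'})"
      using domination_number_eq a(1) by metis
    with that[of d] a(2) mult_le_mono2[OF rH[OF d(4)], of d] show thesis by simp
  qed
  obtain dG where dG: "0 < dG" "rH * dG \<le> card (pverts G)" "card (pverts G) \<le> dG * rG"
  proof -
    obtain d a' where d: "0 < d" "card (closed_neighborhood H {b}) * d \<le> card (pverts G)"
      "a' \<in> pverts G" "card (pverts G) \<le> d * card (closed_neighborhood G {a'})"
      using HG.domination_number_eq b(1) by metis
    with that[of d] b(2) mult_le_mono2[OF rG[OF d(3)], of d] show thesis by simp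
  qed
  have "rG * dH \<le> rH * dH" using dH(3,4) mult.commute[of dH rH] by linarith
  moreover have "rH * dG \<le> rG * dG" using dG(2,3) mult.commute[of dG rG] by linarith
  ultimately have "rG = rH" using dH(1) dG(1) by auto
  moreover have "card (pverts G) = rG * dG" "card (pverts H) = rG * dH"
    using dG(2,3) dH(3,4) \<open>rG = rH\<close> by (simp_all add: mult.commute)
  ultimately show ?thesis
    using dG(1) dH(1,2) rG rH by (intro exI[of _ rG] exI[of _ dG] exI[of _ dH]) simp
qed

end

section \<open>One factor is complete\<close>

text \<open>Start with \<open>u\<close> and \<open>v\<close> in color 0, which is proper because
  they are not adjacent. Every further vertex has fewer than \<open>r\<close> neighbors, so a color
  remains for it.\<close>

lemma greedy_coloring:
  assumes X: "pair_graph X"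
    and deg: "\<And>a. a \<in> pverts X \<Longrightarrow> card (closed_neighborhood X {a}) \<le> r"
    and uv: "u \<in> pverts X" "(u, v) \<notin> parcs X"
  obtains c where "\<And>x. c x < r"
    "\<And>x y. (x, y) \<in> parcs X \<Longrightarrow> c x \<noteq> c y" "c u = c v"
proof -
  have fin: "finite (pverts X)" using X by (rule finite_pverts)
  have cardN: "card {y \<in> pverts X. (x, y) \<in> parcs X} < r" if "x \<in> pverts X" for x
    using deg[OF that] fin parcs_irrefl[OF X, of x] by (simp add: closed_neighborhood_singleton)
  have r: "0 < r" using cardN[OF uv(1)] by simp
  have "B \<subseteq> pverts X \<Longrightarrow> \<exists>c. (\<forall>x. c x < r) \<and> c u = c v \<and>
    (\<forall>x\<in>{u, v} \<union> B. \<forall>y\<in>{u, v} \<union> B. (x, y) \<in> parcs X \<longrightarrow> c x \<noteq> c y)"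
    if "finite B" for B
    using that
  proof induction
    case empty
    have "(v, u) \<notin> parcs X" using uv parcs_sym[OF X] by blast
    then show ?case using uv parcs_irrefl[OF X] r by (intro exI[of _ "\<lambda>_. 0"]) auto
  next
    case (insert x B)
    have "B \<subseteq> pverts X" using insert.prems by simp
    from insert.IH[OF this] obtain c where c: "\<forall>x. c x < r" "c u = c v"
      "\<forall>x\<in>{u, v} \<union> B. \<forall>y\<in>{u, v} \<union> B. (x, y) \<in> parcs X \<longrightarrow> c x \<noteq> c y"
      by (elim exE conjE)
    show ?case
    proof (cases "x \<in> {u, v}")
      case True
      then have "{u, v} \<union> insert x B = {u, v} \<union> B" by blast
      then show ?thesis using c by (intro exI[of _ c]) simp
    next
      case False
      \<comment> \<open>The coloring \<open>c\<close> is total; the new color avoids those of all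
        neighbors of \<open>x\<close>, treated or not.\<close>
      let ?N = "{y \<in> pverts X. (x, y) \<in> parcs X}"
      have "card (c ` ?N) < card {..<r}"
        using card_image_le[of ?N c] cardN[of x] insert.prems fin by simp
      then have "\<not> {..<r} \<subseteq> c ` ?N"
        using card_mono[of "c ` ?N" "{..<r}"] fin by auto
      then obtain k where k: "k < r" "\<And>y. (x, y) \<in> parcs X \<Longrightarrow> c y \<noteq> k"
        using parcs_verts[OF X] by blast
      have k': "c y \<noteq> k" if "(y, x) \<in> parcs X" for y
        using k(2) that parcs_sym[OF X] by blast
      show ?thesis
      proof (intro exI[of _ "c(x := k)"] conjI ballI allI impI)
        fix y z assume yz: "y \<in> {u, v} \<union> insert x B" "z \<in> {u, v} \<union> insert x B" "(y, z) \<in> parcs X"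
        consider "y = x" "z \<noteq> x" | "y \<noteq> x" "z = x" | "y \<noteq> x" "z \<noteq> x"
          using yz(3) parcs_irrefl[OF X] by blast
        then show "(c(x := k)) y \<noteq> (c(x := k)) z"
        proof cases
          case 1
          then show ?thesis using k(2)[of z] yz(3) by auto
        next
          case 2
          then show ?thesis using k'[of y] yz(3) by auto
        next
          case 3
          then have "y \<in> {u, v} \<union> B" "z \<in> {u, v} \<union> B" using yz(1,2) by blast+
          then have "c y \<noteq> c z" using c(3) yz(3) by blast
          then show ?thesis using 3 by simp
        qed
      qed (use False c k in auto)
    qed
  qed
  from this[OF fin subset_refl] obtain c where c: "\<forall>x. c x < r" "c u = c v"
    "\<forall>x\<in>{u, v} \<union> pverts X. \<forall>y\<in>{u, v} \<union> pverts X. (x, y) \<in> parcs X \<longrightarrow> c x \<noteq> c y"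
    by (elim exE conjE)
  show thesis
  proof (rule that[of c])
    show "c x \<noteq> c y" if "(x, y) \<in> parcs X" for x y
      using c(3) that parcs_verts[OF X that] by blast
  qed (use c in auto)
qed

text \<open>
  Two nonadjacent neighbors of \<open>a\<close> get the same color, so one of the \<open>r\<close> colors is missing around \<open>a\<close>.
\<close>

lemma coloring_missing_color:
  assumes X: "pair_graph X" and ind: "indecomposable X"
    and xy: "x \<in> pverts X" "y \<in> pverts X" "x \<noteq> y" "(x, y) \<notin> parcs X"
    and deg: "\<forall>a\<in>pverts X. card (closed_neighborhood X {a}) \<le> r"
  shows "\<exists>c a. (\<forall>x. c x < r) \<and> (\<forall>x y. (x, y) \<in> parcs X \<longrightarrow> c x \<noteq> c y) \<and>
    a \<in> pverts X \<and> c a = 0 \<and> (\<forall>y. (a, y) \<in> parcs X \<longrightarrow> c y \<noteq> 1) \<and> 1 < r"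
proof -
  have fin: "finite (pverts X)" using X by (rule finite_pverts)
  obtain u a v where uav: "(u, a) \<in> parcs X" "(a, v) \<in> parcs X" "u \<noteq> v" "(u, v) \<notin> parcs X"
    using indecomposable_incomplete[OF X ind xy] by blast
  have verts: "u \<in> pverts X" "a \<in> pverts X" "v \<in> pverts X" and au: "(a, u) \<in> parcs X"
    using uav parcs_verts[OF X] parcs_sym[OF X] by blast+
  obtain c where c: "\<And>x. c x < r" "\<And>x y. (x, y) \<in> parcs X \<Longrightarrow> c x \<noteq> c y" "c u = c v"
    using greedy_coloring[OF X _ verts(1) uav(4), of r] deg by blast
  let ?N = "closed_neighborhood X {a}"
  have finN: "finite ?N" and vN: "v \<in> ?N" and uN: "u \<in> ?N"
    using fin uav verts au by (auto simp: closed_neighborhood_singleton)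
  have "c ` ?N = c ` insert v (?N - {v})" using vN by (simp add: insert_absorb)
  also have "\<dots> = insert (c v) (c ` (?N - {v}))" by (rule image_insert)
  also have "\<dots> = c ` (?N - {v})"
    using uN uav(3) c(3) by (intro insert_absorb image_eqI[of _ _ u]) auto
  finally have "c ` ?N = c ` (?N - {v})" .
  then have "card (c ` ?N) \<le> card (?N - {v})" using card_image_le[of "?N - {v}" c] finN by simp
  also have "\<dots> < card ?N" using finN vN by (rule card_Diff1_less)
  also have "\<dots> \<le> card {..<r}" using deg verts by simp
  finally have "\<not> {..<r} \<subseteq> c ` ?N"
    using card_mono[of "c ` ?N" "{..<r}"] finN by auto
  then obtain m where m: "m < r" "m \<notin> c ` ?N" by auto
  have "c a \<noteq> m" using m by (auto simp: closed_neighborhood_singleton)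
  then have r: "1 < r" using c(1)[of a] m(1) by linarith
  \<comment> \<open>Colors are renamed: \<open>p\<close> moves the color of \<open>a\<close> to 0,
    then \<open>q\<close> moves the missing color to 1. As \<open>p m \<noteq> 0\<close>, the second
    transposition fixes 0.\<close>
  define p where "p = transpose 0 (c a)"
  define q where "q = transpose 1 (p m)"
  have p: "p i < r" if "i < r" for i
    using that c(1)[of a] r by (simp add: p_def transpose_def)
  have pc: "p (c a) = 0" by (simp add: p_def)
  have pm: "p m \<noteq> 0" "p m < r"
    using p[OF m(1)] r \<open>c a \<noteq> m\<close> by (auto simp: p_def transpose_def split: if_splits)
  have q: "q i < r" if "i < r" for i
    using that pm r by (simp add: q_def transpose_def)
  have q0: "q 0 = 0" and qm: "q (p m) = 1" using pm by (simp_all add: q_def transpose_def)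
  have inj: "inj (q \<circ> p)" unfolding p_def q_def by (intro inj_compose inj_transpose)
  show ?thesis
  proof (intro exI[of _ "q \<circ> p \<circ> c"] exI[of _ a] conjI)
    show "\<forall>x. (q \<circ> p \<circ> c) x < r" using p q c(1) by simp
    show "\<forall>x y. (x, y) \<in> parcs X \<longrightarrow> (q \<circ> p \<circ> c) x \<noteq> (q \<circ> p \<circ> c) y"
      using c(2) inj by (metis comp_apply injD)
    show "(q \<circ> p \<circ> c) a = 0" using pc q0 by simp
    show "\<forall>y. (a, y) \<in> parcs X \<longrightarrow> (q \<circ> p \<circ> c) y \<noteq> 1"
    proof (intro allI impI)
      fix y assume y: "(a, y) \<in> parcs X"
      then have "c y \<noteq> m"
        using m(2) parcs_verts[OF X y] by (auto simp: closed_neighborhood_singleton)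
      then have "q (p (c y)) \<noteq> q (p m)" using inj by (metis comp_apply injD)
      then show "(q \<circ> p \<circ> c) y \<noteq> 1" using qm by simp
    qed
  qed (use verts r in auto)
qed

definition is_complete :: "'a pair_pre_digraph \<Rightarrow> bool" where
  "is_complete X \<longleftrightarrow> (\<forall>x\<in>pverts X. \<forall>y\<in>pverts X. x \<noteq> y \<longrightarrow> (x, y) \<in> parcs X)"

lemma add_mod_inj: "(x + y) mod r = (x + z) mod r \<Longrightarrow> y < r \<Longrightarrow> z < r \<Longrightarrow> y = z" for x y z r :: nat
proof (induction y z rule: linorder_wlog)
  case (le y z)
  then have "r dvd z - y" using mod_eq_dvd_iff_nat[of "x + y" "x + z" r] by simp
  then show ?case using le dvd_imp_le[of r "z - y"] by (cases "z = y") auto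
qed simp

context well_dominated_product
begin

text \<open>The \<open>r\<close> classes \<open>S k\<close> are independent, so each has at most
  \<gamma> elements, and together they have |G| |H| = r \<gamma>. Thus none can be smaller; but
  \<open>S 1\<close> stays independent when \<open>(a, b)\<close>, whose sum is 0, is added.\<close>

lemma complete_factor: "is_complete G \<or> is_complete H"
proof (rule ccontr)
  assume no: "\<not> ?thesis"
  obtain r dG dH where o: "card (pverts G) = r * dG" "card (pverts H) = r * dH"
    "domination_number (G \<box> H) = r * dG * dH"
    and deg: "\<forall>a\<in>pverts G. card (closed_neighborhood G {a}) \<le> r"
    "\<forall>b\<in>pverts H. card (closed_neighborhood H {b}) \<le> r"
    using orders by (elim exE conjE)
  obtain x x' where x: "x \<in> pverts G" "x' \<in> pverts G" "x \<noteq> x'" "(x, x') \<notin> parcs G"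
    using no unfolding is_complete_def by blast
  obtain y y' where y: "y \<in> pverts H" "y' \<in> pverts H" "y \<noteq> y'" "(y, y') \<notin> parcs H"
    using no unfolding is_complete_def by blast
  obtain c a where c0: "\<forall>x. c x < r" "\<forall>x y. (x, y) \<in> parcs G \<longrightarrow> c x \<noteq> c y"
    "a \<in> pverts G" "c a = 0" "\<forall>y. (a, y) \<in> parcs G \<longrightarrow> c y \<noteq> 1" and r: "1 < r"
    using coloring_missing_color[OF G indecomposable_G x deg(1)] by (elim exE conjE)
  note c = c0(1,2)[rule_format] c0(3,4) c0(5)[rule_format]
  obtain c' b where c0': "\<forall>x. c' x < r" "\<forall>x y. (x, y) \<in> parcs H \<longrightarrow> c' x \<noteq> c' y"
    "b \<in> pverts H" "c' b = 0" "\<forall>y. (b, y) \<in> parcs H \<longrightarrow> c' y \<noteq> 1"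
    using coloring_missing_color[OF H indecomposable_H y deg(2)] by (elim exE conjE)
  note c' = c0'(1,2)[rule_format] c0'(3,4) c0'(5)[rule_format]
  let ?V = "pverts (G \<box> H)" and ?W = "domination_number (G \<box> H)"
  let ?f = "\<lambda>(g, h). (c g + c' h) mod r"
  define S where "S k = {x \<in> ?V. ?f x = k}" for k
  have product: "pair_graph (G \<box> H)" using G H by (rule pair_graph_cartesian_product)
  have f: "?f x \<noteq> ?f y" if xy: "(x, y) \<in> parcs (G \<box> H)" for x y
  proof -
    obtain g h g' h' where e: "x = (g, h)" "y = (g', h')" by fastforce
    from xy consider "g = g'" "(h, h') \<in> parcs H" | "h = h'" "(g, g') \<in> parcs G"
      unfolding e by auto
    then show ?thesis
    proof cases
      case 1
      then show ?thesis
        using c'(1)[of h] c'(1)[of h'] c'(2)[of h h'] add_mod_inj[of "c g" "c' h" r "c' h'"]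
        unfolding e by auto
    next
      case 2
      then show ?thesis
        using c(1)[of g] c(1)[of g'] c(2)[of g g'] add_mod_inj[of "c' h" "c g" r "c g'"]
        unfolding e by (auto simp: add.commute)
    qed
  qed
  have le: "card (S k) \<le> ?W" for k
  proof (rule card_independent_le[OF product well_dominated])
    show "S k \<subseteq> ?V" unfolding S_def by blast
    fix x y assume "x \<in> S k" "y \<in> S k"
    then have "?f x = ?f y" unfolding S_def by (metis (mono_tags, lifting) mem_Collect_eq)
    then show "(x, y) \<notin> parcs (G \<box> H)" using f by blast
  qed
  have ab: "(a, b) \<in> ?V" "(a, b) \<notin> S 1" using c c' r by (auto simp: S_def)
  \<comment> \<open>A neighbor of \<open>(a, b)\<close> keeps one coordinate, which contributes
    color 0. Its sum is therefore the color of a neighbor of \<open>a\<close> or of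
    \<open>b\<close>, which is never 1.\<close>
  have n: "((a, b), x) \<notin> parcs (G \<box> H)" if "x \<in> S 1" for x
    using that c(1)[of "fst x"] c(4) c(5)[of "fst x"] c'(1)[of "snd x"] c'(4) c'(5)[of "snd x"]
    unfolding S_def by (cases x) auto
  have "card (insert (a, b) (S 1)) \<le> ?W"
  proof (rule card_independent_le[OF product well_dominated])
    show "insert (a, b) (S 1) \<subseteq> ?V" using ab by (auto simp: S_def)
    fix x y assume xy: "x \<in> insert (a, b) (S 1)" "y \<in> insert (a, b) (S 1)"
    show "(x, y) \<notin> parcs (G \<box> H)"
    proof (cases "x = (a, b) \<or> y = (a, b)")
      case True
      then show ?thesis
        using xy n parcs_sym[OF product, of x y] parcs_irrefl[OF product] by blast
    next
      case False
      then have "x \<in> S 1" "y \<in> S 1" using xy by blast+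
      then have "?f x = ?f y" unfolding S_def by (metis (mono_tags, lifting) mem_Collect_eq)
      then show ?thesis using f by blast
    qed
  qed
  moreover have finS: "finite (S k)" for k using finite_product by (simp add: S_def)
  ultimately have lt: "card (S 1) < ?W" using ab by simp
  have "?V = (\<Union>k<r. S k)" using r by (auto simp: S_def)
  then have "card ?V = card (\<Union>k<r. S k)" by (rule arg_cong)
  also have "\<dots> = (\<Sum>k<r. card (S k))"
    using finS by (intro card_UN_disjoint) (auto simp: S_def)
  also have "\<dots> < (\<Sum>k<r. ?W)" using le lt r by (intro sum_strict_mono_ex1) auto
  also have "\<dots> = card ?V" using o by (simp add: card_cartesian_product)
  finally show False by simp
qed

end

section \<open>The other factor\<close>

context well_dominated_product
begin

text \<open>A closed neighborhood in \<open>G\<close> is all of \<open>G\<close>, so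
  \<open>r * dG \<le> r\<close> and \<open>dG = 1\<close>.\<close>

lemma complete_orders:
  assumes "is_complete G"
  shows "domination_number (G \<box> H) = card (pverts H)"
    and "b \<in> pverts H \<Longrightarrow> card (closed_neighborhood H {b}) \<le> card (pverts G)"
    and "card (pverts G) \<le> card (pverts H)"
proof -
  obtain r dG dH where o: "card (pverts G) = r * dG" "card (pverts H) = r * dH"
    "domination_number (G \<box> H) = r * dG * dH" "0 < dG" "0 < dH"
    and deg: "\<forall>a\<in>pverts G. card (closed_neighborhood G {a}) \<le> r"
    "\<forall>b\<in>pverts H. card (closed_neighborhood H {b}) \<le> r"
    using orders by (elim exE conjE)
  obtain a where a: "a \<in> pverts G" using card_G by fastforce
  then have "closed_neighborhood G {a} = pverts G"
    using assms by (auto simp: closed_neighborhood_singleton is_complete_def)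
  then have "r * dG \<le> r" using deg(1) a o(1) by fastforce
  moreover have "0 < r" using o(1) card_G by (cases r) auto
  ultimately have "dG = 1" using o(4) by auto
  then show "domination_number (G \<box> H) = card (pverts H)"
    "b \<in> pverts H \<Longrightarrow> card (closed_neighborhood H {b}) \<le> card (pverts G)"
    "card (pverts G) \<le> card (pverts H)"
    using o deg by auto
qed

text \<open>The full layers over \<open>A\<close> dominate all layers over \<open>N[A]\<close>. Each
  remaining layer is a copy of the complete graph \<open>G\<close>, so one vertex dominates
  it.\<close>

lemma fibers_dominating:
  assumes complete: "is_complete G" and A: "A \<subseteq> pverts H" and g: "g \<in> pverts G"
  shows "dominating_set (G \<box> H) (pverts G \<times> A \<union> {g} \<times> (pverts H - closed_neighborhood H A))"
    (is "dominating_set _ ?S")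
  unfolding dominating_set_iff
proof (intro conjI ballI)
  show "?S \<subseteq> pverts (G \<box> H)" using A g by auto
  fix v assume "v \<in> pverts (G \<box> H)"
  then obtain x h where v: "v = (x, h)" "x \<in> pverts G" "h \<in> pverts H" by auto
  show "\<exists>u\<in>?S. u = v \<or> (u, v) \<in> parcs (G \<box> H)"
  proof (cases "h \<in> closed_neighborhood H A")
    case True
    then obtain a where "a \<in> A" "a = h \<or> (a, h) \<in> parcs H"
      unfolding closed_neighborhood_def by blast
    then show ?thesis using v A by (intro bexI[of _ "(x, a)"]) auto
  next
    case False
    then show ?thesis
      using v g complete unfolding is_complete_def by (intro bexI[of _ "(g, h)"]) auto
  qed
qed

lemma card_fibers:
  assumes A: "A \<subseteq> pverts H"
  shows "card (pverts G \<times> A \<union> {g} \<times> (pverts H - closed_neighborhood H A)) + card (closed_neighborhood H A)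
    = card (pverts G) * card A + card (pverts H)"
proof -
  have fin: "finite (pverts G)" "finite (pverts H)" using G H by (simp_all add: finite_pverts)
  have N: "A \<subseteq> closed_neighborhood H A" "closed_neighborhood H A \<subseteq> pverts H"
    using A unfolding closed_neighborhood_def by blast+
  have "card (pverts G \<times> A \<union> {g} \<times> (pverts H - closed_neighborhood H A))
    = card (pverts G \<times> A) + card ({g} \<times> (pverts H - closed_neighborhood H A))"
    using fin A N by (intro card_Un_disjoint) (auto intro: finite_subset)
  also have "\<dots> = card (pverts G) * card A + (card (pverts H) - card (closed_neighborhood H A))"
    using N fin by (simp add: card_cartesian_product card_Diff_subset finite_subset)
  finally show ?thesis using card_mono[OF fin(2) N(2)] by simp
qed

text \<open>
  In the dominating set of \<open>fibers_dominating\<close> only elements of \<open>{g} \<times> (A - B)\<close> can be redundant.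
\<close>

lemma fibers_bound:
  assumes complete: "is_complete G" and A: "A \<subseteq> pverts H" and B: "B \<subseteq> A"
    and priv: "\<And>a. a \<in> A \<Longrightarrow> \<exists>p\<in>closed_neighborhood H A - A. private_neighbor H A a p \<and>
      (a \<in> B \<longrightarrow> closed_neighborhood H {p} \<subseteq> closed_neighborhood H A)"
  shows "(card (pverts G) - 1) * card A + card B \<le> card (closed_neighborhood H A)"
proof -
  let ?N = "closed_neighborhood H A" and ?V = "pverts G"
  obtain g where g: "g \<in> ?V" using card_G by fastforce
  have fin: "finite ?V" "finite (pverts H)" using G H by (simp_all add: finite_pverts)
  have "\<not> ?V \<subseteq> {g}" using card_mono[of "{g}" ?V] card_G by auto
  then obtain g1 where g1: "g1 \<in> ?V" "g1 \<noteq> g" by blast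
  have N: "A \<subseteq> ?N" "?N \<subseteq> pverts H" using A unfolding closed_neighborhood_def by blast+
  let ?C = "pverts H - ?N"
  let ?S = "?V \<times> A \<union> {g} \<times> ?C"
  let ?T = "(?V - {g}) \<times> A \<union> {g} \<times> (B \<union> ?C)"
  have "card ?T \<le> domination_number (G \<box> H)"
  proof (rule card_private_le[OF finite_product well_dominated fibers_dominating[OF complete A g]])
    show "?T \<subseteq> ?S" using B g by blast
    fix x assume "x \<in> ?T"
    then consider y a where "x = (y, a)" "y \<in> ?V" "a \<in> A" "y \<noteq> g \<or> a \<in> B" | h where "x = (g, h)" "h \<in> ?C"
      using B g by auto
    then show "\<exists>v. private_neighbor (G \<box> H) ?S x v"
    proof cases
      case 1
      \<comment> \<open>The private neighbor of \<open>(y, a)\<close> is \<open>(y, p)\<close>. As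
        \<open>p \<notin> A\<close>, it can be dominated only by \<open>(y, h)\<close> with
        \<open>h\<close> adjacent to \<open>p\<close>, and \<open>h \<in> A\<close> forces
        \<open>h = a\<close>. For \<open>y = g\<close> the extra vertices \<open>(g, h)\<close> with
        \<open>h \<notin> N[A]\<close> also compete; the condition on \<open>B\<close> rules them
        out.\<close>
      obtain p where p: "p \<in> ?N" "p \<notin> A" "private_neighbor H A a p"
        "a \<in> B \<Longrightarrow> closed_neighborhood H {p} \<subseteq> ?N"
        using priv[OF 1(3)] by auto
      have p': "h = a" if "h \<in> A" "(h, p) \<in> parcs H" for h
        using p(3) that unfolding private_neighbor_def by blast
      have pB: "h \<in> ?N" if "a \<in> B" "(h, p) \<in> parcs H" for h
        using p(4) that parcs_sym[OF H, of h p] parcs_verts[OF H that(2)]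
        by (auto simp: closed_neighborhood_singleton)
      have "private_neighbor (G \<box> H) ?S x (y, p)"
        unfolding private_neighbor_def
      proof (intro conjI ballI impI)
        show "(y, p) \<in> pverts (G \<box> H)" using 1 p N by auto
        fix u assume u: "u \<in> ?S" "u = (y, p) \<or> (u, (y, p)) \<in> parcs (G \<box> H)"
        obtain y' h where e: "u = (y', h)" by (cases u)
        have "h \<noteq> p" using u(1) p(1,2) unfolding e by auto
        then have yh: "y' = y" "(h, p) \<in> parcs H" using u(2) unfolding e by auto
        have "h \<in> A"
        proof (rule ccontr)
          assume "h \<notin> A"
          then have "y' = g" "h \<notin> ?N" using u(1) unfolding e by auto
          then show False using yh 1(4) pB by blast
        qed
        then show "u = x" using p' yh 1 e by simp
      qed
      then show ?thesis by blast
    next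
      case 2
      \<comment> \<open>The vertex \<open>(g, h)\<close> may have neighbors \<open>(g, h')\<close>
        in the set, so the private neighbor is taken in another fiber, which requires
        \<open>g1 \<noteq> g\<close>.\<close>
      have "private_neighbor (G \<box> H) ?S x (g1, h)"
        unfolding private_neighbor_def
      proof (intro conjI ballI impI)
        show "(g1, h) \<in> pverts (G \<box> H)" using g1 2 by auto
        fix u assume u: "u \<in> ?S" "u = (g1, h) \<or> (u, (g1, h)) \<in> parcs (G \<box> H)"
        obtain y' h' where e: "u = (y', h')" by (cases u)
        have "h' \<notin> A"
        proof
          assume h': "h' \<in> A"
          then have "h' = h \<or> (h', h) \<in> parcs H" using u(2) unfolding e by auto
          then have "h \<in> ?N" using h' 2(2) unfolding closed_neighborhood_def by auto
          then show False using 2(2) by blast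
        qed
        then have "y' = g" using u(1) unfolding e by auto
        then show "u = x" using u(2) g1(2) 2(1) unfolding e by auto
      qed
      then show ?thesis by blast
    qed
  qed
  also have "\<dots> = card (pverts H)" using complete by (rule complete_orders)
  also have "card ?T = (card ?V - 1) * card A + (card B + card ?C)"
  proof -
    have finA: "finite A" "finite B" using A B fin by (auto intro: finite_subset)
    have "card ?T = card ((?V - {g}) \<times> A) + card ({g} \<times> (B \<union> ?C))"
      using fin finA by (intro card_Un_disjoint) auto
    moreover have "card (B \<union> ?C) = card B + card ?C"
      using fin finA B N by (intro card_Un_disjoint) auto
    ultimately show ?thesis using g fin by (simp add: card_cartesian_product)
  qed
  finally show ?thesis
    using N(2) fin card_mono[OF fin(2) N(2)] card_Diff_subset[of ?N "pverts H"]
    by (simp add: finite_subset)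
qed

text \<open>The case \<open>A = {b}\<close>, \<open>B = {}\<close> of \<open>fibers_bound\<close>:
  any neighbor of \<open>b\<close> serves as the private neighbor.\<close>

lemma degree_lower:
  assumes complete: "is_complete G" and b: "b \<in> pverts H"
  shows "card (pverts G) - 1 \<le> card (closed_neighborhood H {b})"
proof -
  obtain p where p: "(b, p) \<in> parcs H"
    using indecomposable_neighbor[OF H indecomposable_H card_H b] by blast
  have "p \<in> closed_neighborhood H {b} - {b}" "private_neighbor H {b} b p"
    using p parcs_verts[OF H p] parcs_irrefl[OF H]
    by (auto simp: closed_neighborhood_singleton private_neighbor_def)
  then show ?thesis using fibers_bound[OF complete, of "{b}" "{}"] b by auto
qed

text \<open>The set of \<open>fibers_dominating\<close> with \<open>A = {a}\<close> now has exactly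
  |H| = \<gamma> elements, so \<open>(g, a)\<close> must have a private neighbor
  \<open>(y, x)\<close>. Here \<open>x \<noteq> a\<close>, because \<open>(g1, a)\<close> dominates
  the whole layer of \<open>a\<close>; hence \<open>y = g\<close>, and no \<open>(g, h)\<close> with
  \<open>h \<notin> N[a]\<close> is adjacent to \<open>(g, x)\<close>.\<close>

lemma absorbed_neighbor:
  assumes complete: "is_complete G" and a: "a \<in> pverts H"
    and card: "card (closed_neighborhood H {a}) = card (pverts G)"
  obtains x where "(a, x) \<in> parcs H" "closed_neighborhood H {x} \<subseteq> closed_neighborhood H {a}"
proof -
  let ?N = "closed_neighborhood H {a}" and ?V = "pverts G"
  obtain g where g: "g \<in> ?V" using card_G by fastforce
  have "\<not> ?V \<subseteq> {g}" using card_mono[of "{g}" ?V] card_G by auto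
  then obtain g1 where g1: "g1 \<in> ?V" "g1 \<noteq> g" by blast
  let ?S = "?V \<times> {a} \<union> {g} \<times> (pverts H - ?N)"
  have aH: "{a} \<subseteq> pverts H" using a by simp
  have "card ?S \<le> domination_number (G \<box> H)"
    using card_fibers[OF aH, of g] card complete_orders(1)[OF complete] by simp
  then obtain v where v: "private_neighbor (G \<box> H) ?S (g, a) v"
    using private_neighbor_of_minimum[OF finite_product fibers_dominating[OF complete aH g]] g by blast
  obtain y x where e: "v = (y, x)" by (cases v)
  have yx: "y \<in> ?V" "x \<in> pverts H" using v unfolding e private_neighbor_def by auto
  have u: "u = (g, a)" if "u \<in> ?S" "u = (y, x) \<or> (u, (y, x)) \<in> parcs (G \<box> H)" for u
    using v that unfolding e private_neighbor_def by blast
  obtain z where z: "z \<in> ?S" "z = (y, x) \<or> (z, (y, x)) \<in> parcs (G \<box> H)"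
    using fibers_dominating[OF complete aH g] yx unfolding dominating_set_iff by (metis e v private_neighbor_def)
  then have za: "z = (g, a)" using u by blast
  have "x \<noteq> a"
  proof
    assume "x = a"
    then have "(g1, a) = (y, x) \<or> ((g1, a), (y, x)) \<in> parcs (G \<box> H)"
      using complete g1 yx unfolding is_complete_def by auto
    then show False using u[of "(g1, a)"] g1 by auto
  qed
  then have y: "y = g" and x: "(a, x) \<in> parcs H" using z(2) unfolding za by auto
  have "closed_neighborhood H {x} \<subseteq> ?N"
  proof
    fix h assume h: "h \<in> closed_neighborhood H {x}"
    show "h \<in> ?N"
    proof (rule ccontr)
      assume n: "h \<notin> ?N"
      have "h \<noteq> x" using n x yx by (auto simp: closed_neighborhood_singleton)
      then have hx: "(x, h) \<in> parcs H" "h \<in> pverts H"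
        using h by (auto simp: closed_neighborhood_singleton)
      then have "((g, h), (y, x)) \<in> parcs (G \<box> H)"
        using y yx parcs_sym[OF H, of x h] by simp
      then have "(g, h) = (g, a)" using u[of "(g, h)"] hx n by blast
      then show False using n by (auto simp: closed_neighborhood_singleton)
    qed
  qed
  with x that show thesis by blast
qed

text \<open>For incomparable neighborhoods, \<open>fibers_bound\<close> with
  \<open>A = {u, v}\<close> and \<open>B = {}\<close> gives 2(|G| - 1) \<le> |N[u] \<union> N[v]|.
  The degree bound and the common elements \<open>u\<close>, \<open>v\<close> make this an equality,
  leaving no room for the improvement by 1 that \<open>B = {u}\<close> yields.\<close>

lemma closed_neighborhoods_comparable:
  assumes complete: "is_complete G" and uv: "(u, v) \<in> parcs H"
  shows "closed_neighborhood H {u} \<subseteq> closed_neighborhood H {v} \<or>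
    closed_neighborhood H {v} \<subseteq> closed_neighborhood H {u}"
proof (rule ccontr)
  let ?Nu = "closed_neighborhood H {u}" and ?Nv = "closed_neighborhood H {v}"
  let ?N = "closed_neighborhood H {u, v}"
  assume no: "\<not> ?thesis"
  have verts: "u \<in> pverts H" "v \<in> pverts H" using parcs_verts[OF H uv] by auto
  have ne: "u \<noteq> v" using uv parcs_irrefl[OF H] by blast
  have uvN: "u \<in> ?Nv" "v \<in> ?Nu" "u \<in> ?Nu" "v \<in> ?Nv"
    using uv verts parcs_sym[OF H, of u v] by (auto simp: closed_neighborhood_singleton)
  have N: "?N = ?Nu \<union> ?Nv" unfolding closed_neighborhood_def by auto
  have fin: "finite ?Nu" "finite ?Nv"
    using finite_pverts[OF H] by (simp_all add: closed_neighborhood_singleton)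
  have privu: "p \<in> ?N - {u, v} \<and> private_neighbor H {u, v} u p" if "p \<in> ?Nu" "p \<notin> ?Nv" for p
    using that uvN verts unfolding N private_neighbor_def
    by (auto simp: closed_neighborhood_singleton)
  have privv: "p \<in> ?N - {u, v} \<and> private_neighbor H {u, v} v p" if "p \<in> ?Nv" "p \<notin> ?Nu" for p
    using that uvN verts unfolding N private_neighbor_def
    by (auto simp: closed_neighborhood_singleton)
  obtain pu pv where p: "pu \<in> ?Nu" "pu \<notin> ?Nv" "pv \<in> ?Nv" "pv \<notin> ?Nu" using no by blast
  have priv: "\<exists>p\<in>?N - {u, v}. private_neighbor H {u, v} a p \<and> (a \<in> {} \<longrightarrow> closed_neighborhood H {p} \<subseteq> ?N)"
    if "a \<in> {u, v}" for a
    using that privu[OF p(1,2)] privv[OF p(3,4)] by blast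
  have "(card (pverts G) - 1) * card {u, v} + card ({} :: 'b set) \<le> card ?N"
    using verts by (intro fibers_bound[OF complete _ _ priv]) auto
  then have ge: "2 * (card (pverts G) - 1) \<le> card (?Nu \<union> ?Nv)" using ne N by simp
  have un: "card (?Nu \<union> ?Nv) + card (?Nu \<inter> ?Nv) = card ?Nu + card ?Nv"
    using card_Un_Int[OF fin] by simp
  have le: "card ?Nu \<le> card (pverts G)" "card ?Nv \<le> card (pverts G)"
    using complete_orders(2)[OF complete] verts by auto
  have sub: "{u, v} \<subseteq> ?Nu \<inter> ?Nv" using uvN by blast
  then have "card {u, v} \<le> card (?Nu \<inter> ?Nv)" using fin by (intro card_mono) auto
  then have "2 \<le> card (?Nu \<inter> ?Nv)" using ne by simp
  then have eq: "card (?Nu \<inter> ?Nv) = card {u, v}" "card ?Nu = card (pverts G)"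
    "card (?Nu \<union> ?Nv) = 2 * (card (pverts G) - 1)"
    using ge un le card_G ne by (auto simp: le_diff_conv)
  then have int: "?Nu \<inter> ?Nv = {u, v}" using sub fin by (metis card_subset_eq finite_Int)
  \<comment> \<open>The intersection is just \<open>{u, v}\<close>, and \<open>x \<noteq> v\<close>
    because \<open>N[v]\<close> is not contained in \<open>N[u]\<close>. So \<open>x\<close> is a
    private neighbor of \<open>u\<close> whose closed neighborhood stays inside \<open>N[u]\<close>,
    as \<open>B = {u}\<close> demands.\<close>
  obtain x where x: "(u, x) \<in> parcs H" "closed_neighborhood H {x} \<subseteq> ?Nu"
    using absorbed_neighbor[OF complete verts(1) eq(2)] by blast
  have "x \<in> ?Nu" "x \<noteq> u" "x \<noteq> v"
    using x no parcs_verts[OF H x(1)] parcs_irrefl[OF H] by (auto simp: closed_neighborhood_singleton)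
  then have x': "x \<in> ?Nu" "x \<notin> ?Nv" using int by auto
  have priv': "\<exists>p\<in>?N - {u, v}. private_neighbor H {u, v} a p \<and> (a \<in> {u} \<longrightarrow> closed_neighborhood H {p} \<subseteq> ?N)"
    if "a \<in> {u, v}" for a
    using that privu[OF x'] privv[OF p(3,4)] x(2) ne N by blast
  have "(card (pverts G) - 1) * card {u, v} + card {u} \<le> card ?N"
    using verts by (intro fibers_bound[OF complete _ _ priv']) auto
  then show False using eq(3) ne N by simp
qed

text \<open>Take \<open>a\<close> with the largest closed neighborhood. By comparability
  \<open>N[x] \<subseteq> N[a]\<close> for every neighbor \<open>x\<close>, so no arc leaves
  \<open>N[a]\<close> and it is all of \<open>H\<close>. Then |H| = |N[a]| \<le> |G| \<le>
  |H|.\<close>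

lemma universal_vertex:
  assumes complete: "is_complete G"
  obtains a where "a \<in> pverts H" "\<And>x. x \<in> pverts H \<Longrightarrow> x \<noteq> a \<Longrightarrow> (a, x) \<in> parcs H"
    "card (pverts H) = card (pverts G)"
proof -
  have fin: "finite (pverts H)" using H by (rule finite_pverts)
  let ?c = "\<lambda>a. card (closed_neighborhood H {a})"
  have "pverts H \<noteq> {}" using card_H by auto
  then have "Max (?c ` pverts H) \<in> ?c ` pverts H" using fin by (intro Max_in) auto
  then obtain a where a: "a \<in> pverts H" "?c a = Max (?c ` pverts H)" by auto
  have max: "?c b \<le> ?c a" if "b \<in> pverts H" for b using that a(2) fin by simp
  have finN: "finite (closed_neighborhood H {b})" for b
    using fin by (simp add: closed_neighborhood_singleton)
  have "closed_neighborhood H {a} = pverts H"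
  proof (rule indecomposableD[OF indecomposable_H, of _ a])
    show "closed_neighborhood H {a} \<subseteq> pverts H" "a \<in> closed_neighborhood H {a}"
      using a by (auto simp: closed_neighborhood_singleton)
    fix x y assume x: "x \<in> closed_neighborhood H {a}" and y: "(x, y) \<in> parcs H"
    have yx: "y \<in> closed_neighborhood H {x}" "x \<in> pverts H"
      using y parcs_verts[OF H y] by (auto simp: closed_neighborhood_singleton)
    show "y \<in> closed_neighborhood H {a}"
    proof (cases "x = a")
      case False
      then have "(a, x) \<in> parcs H" using x by (auto simp: closed_neighborhood_singleton)
      then consider "closed_neighborhood H {a} \<subseteq> closed_neighborhood H {x}"
        | "closed_neighborhood H {x} \<subseteq> closed_neighborhood H {a}"
        using closed_neighborhoods_comparable[OF complete] by blast
      then have "closed_neighborhood H {x} \<subseteq> closed_neighborhood H {a}"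
        using max[OF yx(2)] card_seteq[OF finN[of x]] by cases auto
      then show ?thesis using yx by blast
    qed (use yx in simp)
  qed
  then show thesis
    using that[of a] a complete_orders(2)[OF complete, of a] complete_orders(3)[OF complete]
    by (auto simp: closed_neighborhood_singleton)
qed

text \<open>By \<open>degree_lower\<close> and |H| = |G| each vertex has at most one nonneighbor, so
  distinct nonedges are disjoint. Then \<open>u\<close> and \<open>w\<close> are adjacent, but
  \<open>N[u]\<close> misses only \<open>u'\<close> and \<open>N[w]\<close> only \<open>w'\<close>,
  so they are incomparable.\<close>

lemma unique_nonedge:
  assumes complete: "is_complete G"
    and u: "u \<in> pverts H" "u' \<in> pverts H" "u \<noteq> u'" "(u, u') \<notin> parcs H"
    and w: "w \<in> pverts H" "w' \<in> pverts H" "w \<noteq> w'" "(w, w') \<notin> parcs H"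
  shows "{w, w'} = {u, u'}"
proof -
  have fin: "finite (pverts H)" using H by (rule finite_pverts)
  have card_eq: "card (pverts H) = card (pverts G)"
    using universal_vertex[OF complete] by blast
  have nbh: "closed_neighborhood H {x} = pverts H - {x'}"
    if x: "x \<in> pverts H" "x' \<in> pverts H" "x \<noteq> x'" "(x, x') \<notin> parcs H" for x x'
  proof (rule card_seteq)
    show "closed_neighborhood H {x} \<subseteq> pverts H - {x'}"
      using x by (auto simp: closed_neighborhood_singleton)
    show "card (pverts H - {x'}) \<le> card (closed_neighborhood H {x})"
      using degree_lower[OF complete x(1)] x(2) card_eq by simp
  qed (use fin in simp)
  have sym: "(u', u) \<notin> parcs H" "(w', w) \<notin> parcs H" using u w parcs_sym[OF H] by blast+
  note Nu = nbh[OF u] and Nu' = nbh[OF u(2,1) u(3)[symmetric] sym(1)]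
    and Nw = nbh[OF w]
  have adj: "(x, y) \<in> parcs H" if "closed_neighborhood H {x} = pverts H - {x'}"
    "y \<in> pverts H" "y \<noteq> x" "y \<noteq> x'" for x x' y
    using that by (auto simp: closed_neighborhood_singleton)
  show ?thesis
  proof (cases "w \<in> {u, u'}")
    case True
    then show ?thesis
    proof
      assume "w = u"
      then have "w' = u'" using Nu Nw w u by blast
      with \<open>w = u\<close> show ?thesis by simp
    next
      assume "w \<in> {u'}"
      then have "w = u'" by simp
      then have "w' = u" using Nu' Nw w u by blast
      with \<open>w = u'\<close> show ?thesis by auto
    qed
  next
    case False
    then have uw: "(u, w) \<in> parcs H" using adj[OF Nu w(1)] by blast
    have "w' \<noteq> u'"
    proof
      assume "w' = u'"
      then have "(u', w) \<notin> parcs H" using sym by simp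
      then show False using adj[OF Nu' w(1)] False by blast
    qed
    moreover have "w' \<noteq> u" using uw sym(2) by blast
    ultimately show ?thesis
      using closed_neighborhoods_comparable[OF complete uw] Nu Nw u w by blast
  qed
qed

end

section \<open>Isomorphisms onto products of paths and complete graphs\<close>

lemma graph_isomorphic_product:
  assumes "graph_isomorphic X X'" "graph_isomorphic Y Y'"
  shows "graph_isomorphic (X \<box> Y) (X' \<box> Y')"
proof -
  obtain f where f: "bij_betw f (pverts X) (pverts X')"
    "\<And>u v. u\<in>pverts X \<Longrightarrow> v\<in>pverts X \<Longrightarrow> (u, v) \<in> parcs X \<longleftrightarrow> (f u, f v) \<in> parcs X'"
    using assms(1) unfolding graph_isomorphic_def by blast
  obtain g where g: "bij_betw g (pverts Y) (pverts Y')"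
    "\<And>u v. u\<in>pverts Y \<Longrightarrow> v\<in>pverts Y \<Longrightarrow> (u, v) \<in> parcs Y \<longleftrightarrow> (g u, g v) \<in> parcs Y'"
    using assms(2) unfolding graph_isomorphic_def by blast
  have inj: "f x = f x' \<longleftrightarrow> x = x'" if "x \<in> pverts X" "x' \<in> pverts X" for x x'
    using f(1) that by (auto simp: bij_betw_def dest: inj_onD)
  have inj': "g x = g x' \<longleftrightarrow> x = x'" if "x \<in> pverts Y" "x' \<in> pverts Y" for x x'
    using g(1) that by (auto simp: bij_betw_def dest: inj_onD)
  have mem: "f x \<in> pverts X'" if "x \<in> pverts X" for x using f(1) that by (rule bij_betwE[rule_format])
  have mem': "g x \<in> pverts Y'" if "x \<in> pverts Y" for x using g(1) that by (rule bij_betwE[rule_format])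
  have "bij_betw (map_prod f g) (pverts (X \<box> Y)) (pverts (X' \<box> Y'))"
    using f(1) g(1) by (simp add: bij_betw_map_prod)
  then show ?thesis
    unfolding graph_isomorphic_def
    by (intro exI[of _ "map_prod f g"] conjI) (auto simp: f(2) g(2) inj inj' mem mem')
qed

lemma complete_isomorphic:
  assumes X: "pair_graph X" and "is_complete X"
  shows "graph_isomorphic X (complete_graph (card (pverts X)))"
proof -
  obtain f where f: "bij_betw f (pverts X) {0..<card (pverts X)}"
    using ex_bij_betw_finite_nat[OF finite_pverts[OF X]] by blast
  have arc: "(u, v) \<in> parcs X \<longleftrightarrow> u \<noteq> v" if "u \<in> pverts X" "v \<in> pverts X" for u v
    using assms(2) that parcs_irrefl[OF X] unfolding is_complete_def by blast
  have "f u < card (pverts X)" if "u \<in> pverts X" for u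
    using bij_betwE[OF f] that by auto
  moreover have "f u = f v \<longleftrightarrow> u = v" if "u \<in> pverts X" "v \<in> pverts X" for u v
    using f that by (auto simp: bij_betw_def dest: inj_onD)
  ultimately show ?thesis
    unfolding graph_isomorphic_def
    using f by (intro exI[of _ f]) (auto simp: complete_graph_def arc atLeast0LessThan)
qed

lemma path_isomorphic:
  assumes X: "pair_graph X" and V: "pverts X = {u, a, v}" and ne: "u \<noteq> a" "v \<noteq> a" "u \<noteq> v"
    and arcs: "(a, u) \<in> parcs X" "(a, v) \<in> parcs X" "(u, v) \<notin> parcs X"
  shows "graph_isomorphic X (path_graph 3)"
proof -
  have "(u, a) \<in> parcs X" "(v, a) \<in> parcs X" "(v, u) \<notin> parcs X"
    using arcs parcs_sym[OF X] by blast+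
  then have all: "(u, a) \<in> parcs X \<and> (a, u) \<in> parcs X \<and> (v, a) \<in> parcs X \<and> (a, v) \<in> parcs X \<and>
    (u, v) \<notin> parcs X \<and> (v, u) \<notin> parcs X \<and> (u, u) \<notin> parcs X \<and> (v, v) \<notin> parcs X \<and> (a, a) \<notin> parcs X"
    using arcs parcs_irrefl[OF X] by blast
  have "{..<3::nat} = {0, 1, 2}" by auto
  then show ?thesis
    unfolding graph_isomorphic_def V
    using ne all by (intro exI[of _ "\<lambda>x. if x = u then 0 else if x = a then 1 else 2"])
      (auto simp: path_graph_def bij_betw_def inj_on_def)
qed

context well_dominated_product
begin

text \<open>A fourth vertex \<open>w\<close> of \<open>H\<close> gives a dominating set of |G| + 1
  vertices, all with private neighbors, although \<gamma> = |H| = |G|. So \<open>H\<close> is the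
  path \<open>u\<close>, \<open>a\<close>, \<open>u'\<close>, and |G| = 3.\<close>

lemma incomplete_factor:
  assumes complete: "is_complete G"
    and u: "u \<in> pverts H" "u' \<in> pverts H" "u \<noteq> u'" "(u, u') \<notin> parcs H"
  shows "graph_isomorphic (G \<box> H) (complete_graph 3 \<box> path_graph 3)"
proof -
  obtain a where a: "a \<in> pverts H" "\<And>x. x \<in> pverts H \<Longrightarrow> x \<noteq> a \<Longrightarrow> (a, x) \<in> parcs H"
    "card (pverts H) = card (pverts G)"
    using universal_vertex[OF complete] by blast
  have au: "a \<noteq> u" "a \<noteq> u'"
    using a(2)[of u] a(2)[of u'] u parcs_sym[OF H, of u u'] by auto
  have fin: "finite (pverts G)" using G by (rule finite_pverts)
  obtain g where g: "g \<in> pverts G" using card_G by fastforce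
  have "w \<in> {u, a, u'}" if w: "w \<in> pverts H" for w
  proof (rule ccontr)
    assume n: "w \<notin> {u, a, u'}"
    let ?S = "{(g, u), (g, u')} \<union> (pverts G - {g}) \<times> {a}"
    have "dominating_set (G \<box> H) ?S"
      unfolding dominating_set_iff
    proof (intro conjI ballI)
      show "?S \<subseteq> pverts (G \<box> H)" using u a g by auto
      fix v assume "v \<in> pverts (G \<box> H)"
      then obtain x h where v: "v = (x, h)" "x \<in> pverts G" "h \<in> pverts H" by auto
      show "\<exists>z\<in>?S. z = v \<or> (z, v) \<in> parcs (G \<box> H)"
      proof (cases "x = g")
        case True
        \<comment> \<open>\<open>u\<close> has no nonneighbor besides \<open>u'\<close>, so
          \<open>(g, u)\<close> and \<open>(g, u')\<close> dominate the fiber over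
          \<open>g\<close>.\<close>
        have "h = u' \<or> h = u \<or> (u, h) \<in> parcs H"
          using unique_nonedge[OF complete u u(1) v(3)] by (auto simp: doubleton_eq_iff)
        then show ?thesis using v g u True by auto
      next
        case False
        then show ?thesis using v a by (intro bexI[of _ "(x, a)"]) auto
      qed
    qed
    then have "card ?S \<le> domination_number (G \<box> H)"
    proof (rule card_private_le[OF finite_product well_dominated _ subset_refl])
      fix x assume "x \<in> ?S"
      then consider "x = (g, u)" | "x = (g, u')" | y where "x = (y, a)" "y \<in> pverts G" "y \<noteq> g"
        by blast
      then show "\<exists>v. private_neighbor (G \<box> H) ?S x v"
      proof cases
        case 1
        then have "private_neighbor (G \<box> H) ?S x x"
          using u au g parcs_sym[OF H, of u u'] unfolding private_neighbor_def by auto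
        then show ?thesis by blast
      next
        case 2
        then have "private_neighbor (G \<box> H) ?S x x"
          using u au g unfolding private_neighbor_def by auto
        then show ?thesis by blast
      next
        case 3
        \<comment> \<open>Every element of the set other than \<open>(y, a)\<close> differs from
          \<open>(y, w)\<close> in both coordinates.\<close>
        then have "private_neighbor (G \<box> H) ?S x (y, w)"
          using n w unfolding private_neighbor_def by auto
        then show ?thesis by blast
      qed
    qed
    also have "\<dots> = card (pverts G)" using complete_orders(1)[OF complete] a(3) by simp
    also have "card ?S = card {(g, u), (g, u')} + card ((pverts G - {g}) \<times> {a})"
      using fin by (intro card_Un_disjoint) auto
    finally show False using g u(3) fin card_G by (simp add: card_cartesian_product)
  qed
  then have V: "pverts H = {u, a, u'}" using u a by blast
  then have "card (pverts G) = 3" using a(3) au u(3) by simp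
  moreover have "graph_isomorphic H (path_graph 3)"
    using path_isomorphic[OF H V] au u a(2) by metis
  ultimately show ?thesis
    using graph_isomorphic_product complete_isomorphic[OF G complete] by metis
qed

lemma isomorphic_of_complete:
  assumes complete: "is_complete G"
  shows "graph_isomorphic (G \<box> H) (complete_graph 3 \<box> path_graph 3) \<or>
    (\<exists>n\<ge>2. graph_isomorphic (G \<box> H) (complete_graph n \<box> complete_graph n))"
proof (cases "is_complete H")
  case True
  have "card (pverts H) = card (pverts G)" using universal_vertex[OF complete] by blast
  then have "graph_isomorphic (G \<box> H) (complete_graph (card (pverts G)) \<box> complete_graph (card (pverts G)))"
    using graph_isomorphic_product[OF complete_isomorphic[OF G complete] complete_isomorphic[OF H True]]
    by simp
  then show ?thesis using card_G by blast
next
  case False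
  then show ?thesis using incomplete_factor[OF complete] unfolding is_complete_def by blast
qed

lemma isomorphic:
  "graph_isomorphic (G \<box> H) (path_graph 3 \<box> complete_graph 3) \<or>
    (\<exists>n\<ge>2. graph_isomorphic (G \<box> H) (complete_graph n \<box> complete_graph n))"
proof (cases "is_complete G")
  case True
  then show ?thesis
    using isomorphic_of_complete graph_isomorphic_trans product_commute by blast
next
  case False
  interpret HG: well_dominated_product H G by (rule swap)
  have "is_complete H" using False complete_factor by blast
  then consider "graph_isomorphic (H \<box> G) (complete_graph 3 \<box> path_graph 3)"
    | n where "n \<ge> 2" "graph_isomorphic (H \<box> G) (complete_graph n \<box> complete_graph n)"
    using HG.isomorphic_of_complete by blast
  then show ?thesis
  proof cases
    case 1
    then show ?thesis using graph_isomorphic_trans product_commute by metis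
  next
    case 2
    then show ?thesis using graph_isomorphic_trans product_commute by metis
  qed
qed

end

section \<open>The well-dominated examples\<close>

text \<open>Each fiber \<open>{x} \<times> V(K_m)\<close> is complete, so any one of its vertices
  dominates it.\<close>

lemma row_section_dominating:
  assumes "\<And>x. x \<in> pverts X \<Longrightarrow> f x < m"
  shows "dominating_set (X \<box> complete_graph m) ((\<lambda>x. (x, f x)) ` pverts X)"
  unfolding dominating_set_iff using assms by (auto simp: complete_graph_def)

lemma column_section_dominating:
  assumes "\<And>y. y \<in> pverts Y \<Longrightarrow> f y < m"
  shows "dominating_set (complete_graph m \<box> Y) ((\<lambda>y. (f y, y)) ` pverts Y)"
  unfolding dominating_set_iff using assms by (auto simp: complete_graph_def)

lemma pverts_complete_graph [simp]: "pverts (complete_graph n) = {..<n}"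
  by (simp add: complete_graph_def)

lemma pverts_path_graph [simp]: "pverts (path_graph n) = {..<n}"
  by (simp add: path_graph_def)

text \<open>If a dominating set misses row \<open>i\<close>, then \<open>(i, j)\<close> can be
  dominated only from column \<open>j\<close>. So every dominating set meets all rows or all
  columns, and one vertex from each suffices.\<close>

lemma well_dominated_complete_product: "well_dominated (complete_graph n \<box> complete_graph n)"
proof (rule well_dominatedI)
  show "finite (pverts (complete_graph n \<box> complete_graph n))" by simp
  fix S assume S: "dominating_set (complete_graph n \<box> complete_graph n) S"
  have SV: "S \<subseteq> {..<n} \<times> {..<n}" using S by (simp add: dominating_set_def)
  show "\<exists>D\<subseteq>S. dominating_set (complete_graph n \<box> complete_graph n) D \<and> card D = n"
  proof (cases "\<forall>i<n. \<exists>j. (i, j) \<in> S")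
    case True
    then obtain f where f: "\<And>i. i < n \<Longrightarrow> (i, f i) \<in> S" by metis
    then have "dominating_set (complete_graph n \<box> complete_graph n) ((\<lambda>i. (i, f i)) ` {..<n})"
      using row_section_dominating[of "complete_graph n" f n] SV by auto
    moreover have "card ((\<lambda>i. (i, f i)) ` {..<n}) = n"
      by (simp add: card_image inj_on_def)
    ultimately show ?thesis using f by (intro exI[of _ "(\<lambda>i. (i, f i)) ` {..<n}"]) auto
  next
    case False
    then obtain i where i: "i < n" "\<And>j. (i, j) \<notin> S" by blast
    have "\<exists>k. (k, j) \<in> S" if j: "j < n" for j
    proof -
      have "(i, j) \<in> pverts (complete_graph n \<box> complete_graph n)" using i j by simp
      then obtain k l where "(k, l) \<in> S"
        "(k, l) = (i, j) \<or> ((k, l), (i, j)) \<in> parcs (complete_graph n \<box> complete_graph n)"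
        using S unfolding dominating_set_iff by (metis surj_pair)
      then show ?thesis using i(2) by auto
    qed
    then obtain f where f: "\<And>j. j < n \<Longrightarrow> (f j, j) \<in> S" by metis
    then have "dominating_set (complete_graph n \<box> complete_graph n) ((\<lambda>j. (f j, j)) ` {..<n})"
      using column_section_dominating[of "complete_graph n" f n] SV by auto
    moreover have "card ((\<lambda>j. (f j, j)) ` {..<n}) = n"
      by (simp add: card_image inj_on_def)
    ultimately show ?thesis using f by (intro exI[of _ "(\<lambda>j. (f j, j)) ` {..<n}"]) auto
  qed
qed

text \<open>If all three rows are met, one vertex from each suffices. If an end row is missed, the
  whole middle row lies in \<open>S\<close> and dominates. If the middle row is missed, one end
  vertex per column is chosen so that both end rows occur.\<close>

lemma well_dominated_path_complete: "well_dominated (path_graph 3 \<box> complete_graph 3)"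
proof (rule well_dominatedI)
  let ?X = "path_graph 3 \<box> complete_graph 3"
  show "finite (pverts ?X)" by simp
  fix S assume S: "dominating_set ?X S"
  have SV: "S \<subseteq> {..<3} \<times> {..<3}" using S by (simp add: dominating_set_def)
  have less3: "i < 3 \<longleftrightarrow> i = 0 \<or> i = 1 \<or> i = 2" for i :: nat by auto
  have arcs: "((i, j), (i', j')) \<in> parcs ?X \<longleftrightarrow> i < 3 \<and> i' < 3 \<and> j < 3 \<and> j' < 3 \<and>
    (i = i' \<and> j \<noteq> j' \<or> j = j' \<and> (i' = Suc i \<or> i = Suc i'))" for i j i' j'
    by (auto simp: path_graph_def complete_graph_def)
  have dom: "\<exists>k l. (k, l) \<in> S \<and> (k = i \<or> l = j \<and> (i = Suc k \<or> k = Suc i))"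
    if "i < 3" "j < 3" for i j
  proof -
    have "(i, j) \<in> pverts ?X" using that by simp
    then obtain k l where "(k, l) \<in> S" "(k, l) = (i, j) \<or> ((k, l), (i, j)) \<in> parcs ?X"
      using S unfolding dominating_set_iff by (metis surj_pair)
    then show ?thesis unfolding arcs by auto
  qed
  \<comment> \<open>One vertex is taken from each column. A row is dominated if it contains a chosen
    vertex, being complete, or if it is next to the chosen vertex of every column.\<close>
  have column: "\<exists>D\<subseteq>S. dominating_set ?X D \<and> card D = 3" if f: "\<And>j. j < 3 \<Longrightarrow> (f j, j) \<in> S"
    and fdom: "\<And>i. i < 3 \<Longrightarrow> i \<in> f ` {..<3} \<or> (\<forall>j<3. i = Suc (f j) \<or> f j = Suc i)" for f
  proof -
    have "dominating_set ?X ((\<lambda>j. (f j, j)) ` {..<3})"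
      unfolding dominating_set_iff
    proof (intro conjI ballI)
      show "(\<lambda>j. (f j, j)) ` {..<3} \<subseteq> pverts ?X" using f SV by auto
      fix v assume "v \<in> pverts ?X"
      then obtain i j where v: "v = (i, j)" "i < 3" "j < 3" by auto
      from fdom[OF v(2)] show "\<exists>u\<in>(\<lambda>j. (f j, j)) ` {..<3}. u = v \<or> (u, v) \<in> parcs ?X"
      proof
        assume "i \<in> f ` {..<3}"
        then obtain k where "k < 3" "i = f k" by auto
        then show ?thesis using v by (intro bexI[of _ "(f k, k)"]) (auto simp: arcs simp del: parcs_product)
      next
        assume "\<forall>j<3. i = Suc (f j) \<or> f j = Suc i"
        moreover have "f j < 3" using f[OF v(3)] SV by auto
        ultimately show ?thesis using v by (intro bexI[of _ "(f j, j)"]) (auto simp: arcs simp del: parcs_product)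
      qed
    qed
    moreover have "card ((\<lambda>j. (f j, j)) ` {..<3::nat}) = 3"
      by (simp add: card_image inj_on_def)
    ultimately show ?thesis using f by (intro exI[of _ "(\<lambda>j. (f j, j)) ` {..<3}"]) auto
  qed
  show "\<exists>D\<subseteq>S. dominating_set ?X D \<and> card D = 3"
  proof (cases "\<forall>i<3. \<exists>j. (i, j) \<in> S")
    case True
    then obtain f where f: "\<And>i. i < 3 \<Longrightarrow> (i, f i) \<in> S" by metis
    then have "dominating_set ?X ((\<lambda>i. (i, f i)) ` {..<3})"
      using row_section_dominating[of "path_graph 3" f 3] SV by auto
    moreover have "card ((\<lambda>i. (i, f i)) ` {..<3::nat}) = 3"
      by (simp add: card_image inj_on_def)
    ultimately show ?thesis using f by (intro exI[of _ "(\<lambda>i. (i, f i)) ` {..<3}"]) auto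
  next
    case False
    then consider "\<And>j. (0, j) \<notin> S" | "\<And>j. (2, j) \<notin> S" | "\<And>j. (1, j) \<notin> S"
      unfolding less3 by blast
    then show ?thesis
    proof cases
      case 1
      then have "(1, j) \<in> S" if "j < 3" for j using dom[of 0 j] that by auto
      then show ?thesis by (intro column[of "\<lambda>_. 1"]) (auto simp: less3)
    next
      case 2
      then have "(1, j) \<in> S" if "j < 3" for j
        using dom[of 2 j] that SV by (auto simp: numeral_2_eq_2)
      then show ?thesis by (intro column[of "\<lambda>_. 1"]) (auto simp: less3)
    next
      case 3
      have ends: "(0, j) \<in> S \<or> (2, j) \<in> S" if "j < 3" for j
        using dom[of 1 j] that 3 by (auto simp: numeral_2_eq_2)
      obtain k where k: "(0, k) \<in> S" "k < 3" using dom[of 0 0] 3 SV by auto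
      obtain l where l: "(2, l) \<in> S" "l < 3"
        using dom[of 2 0] 3 SV by (auto simp: numeral_2_eq_2)
      \<comment> \<open>Both end rows must be hit. For \<open>k \<noteq> l\<close> columns
        \<open>k\<close> and \<open>l\<close> do this. Otherwise column \<open>k\<close> contains
        both ends, so it supplies the end that another column \<open>m\<close> does not use.\<close>
      obtain f where f: "\<And>j. j < 3 \<Longrightarrow> (f j, j) \<in> S \<and> (f j = 0 \<or> f j = 2)"
        and f02: "(0::nat) \<in> f ` {..<3}" "2 \<in> f ` {..<3}"
      proof (cases "k = l")
        case False
        define f where "f j = (if j = k then 0 else if j = l then 2 else if (0, j) \<in> S then 0 else 2 :: nat)" for j
        show thesis
          using ends k l False by (intro that[of f]) (auto simp: f_def image_iff)
      next
        case True
        obtain m where m: "m < 3" "m \<noteq> k" using less3[of k] k by (metis less3 zero_neq_one)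
        define f where "f j = (if j = m then if (0, m) \<in> S then 0 else 2
          else if j = k then if (0, m) \<in> S then 2 else 0 else if (0, j) \<in> S then 0 else 2 :: nat)" for j
        show thesis
          using ends[of m] ends k l True m by (intro that[of f]) (auto simp: f_def image_iff)
      qed
      show ?thesis
      proof (rule column[of f])
        fix i :: nat assume i: "i < 3"
        have "\<forall>j<3. 1 = Suc (f j) \<or> f j = Suc 1"
        proof (intro allI impI)
          fix j :: nat assume "j < 3"
          then have "f j = 0 \<or> f j = 2" using f by blast
          then show "1 = Suc (f j) \<or> f j = Suc 1" by auto
        qed
        with i f02 show "i \<in> f ` {..<3} \<or> (\<forall>j<3. i = Suc (f j) \<or> f j = Suc i)"
          unfolding less3[of i] by blast
      qed (use f in blast)
    qed
  qed
qed

theorem corollary1: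
  fixes G :: "'a pair_pre_digraph" and H :: "'b pair_pre_digraph"
  assumes "pair_graph G" and "pair_graph H"
    and "card (pverts G) \<ge> 2" and "card (pverts H) \<ge> 2"
    and "connected (with_proj (G \<box> H))"
  shows "well_dominated (G \<box> H) \<longleftrightarrow>
    digraph_iso (with_proj (G \<box> H)) (with_proj (path_graph 3 \<box> complete_graph 3)) \<or>
    (\<exists>n\<ge>2. digraph_iso (with_proj (G \<box> H)) (with_proj (complete_graph n \<box> complete_graph n)))"
proof -
  have GH: "pair_graph (G \<box> H)" using assms(1,2) by (rule pair_graph_cartesian_product)
  have P: "pair_graph (path_graph 3 \<box> complete_graph 3)"
    by (intro pair_graph_cartesian_product pair_graph_path_graph pair_graph_complete_graph)
  have K: "pair_graph (complete_graph n \<box> complete_graph n)" for n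
    by (intro pair_graph_cartesian_product pair_graph_complete_graph)
  have iso: "digraph_iso (with_proj (G \<box> H)) (with_proj Y) \<longleftrightarrow> graph_isomorphic (G \<box> H) Y"
    if "pair_graph Y" for Y
    unfolding graph_isomorphic_def using GH that by (rule digraph_iso_pair_iff)
  show ?thesis
    unfolding iso[OF P] iso[OF K]
  proof
    assume "well_dominated (G \<box> H)"
    then interpret well_dominated_product G H
      using assms indecomposable_factors[OF assms(1,2,5)] by (simp add: well_dominated_product_def)
    show "graph_isomorphic (G \<box> H) (path_graph 3 \<box> complete_graph 3) \<or>
      (\<exists>n\<ge>2. graph_isomorphic (G \<box> H) (complete_graph n \<box> complete_graph n))"
      by (rule isomorphic)
  next
    assume "graph_isomorphic (G \<box> H) (path_graph 3 \<box> complete_graph 3) \<or>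
      (\<exists>n\<ge>2. graph_isomorphic (G \<box> H) (complete_graph n \<box> complete_graph n))"
    then show "well_dominated (G \<box> H)"
      using well_dominated_isomorphic[OF finite_pverts[OF GH] finite_pverts[OF P]]
        well_dominated_isomorphic[OF finite_pverts[OF GH] finite_pverts[OF K]]
        well_dominated_path_complete well_dominated_complete_product by blast
  qed
qed

end
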